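(* Let a symmetric positive definite matrix $A$ and a vector $b$ have the structure $$A=PTP^{T},\qquad b=\widetilde{\beta}_{1}Pe_{1},$$ where $P\in\mathbb{F}^{n\times n}$ is a signed permutation matrix, $\widetilde\beta_1\in\mathbb{F}$, and $T\in\mathbb{F}^{n\times n}$ is symmetric tridiagonal with diagonal entries $\widetilde\alpha_1,\dots,\widetilde\alpha_n$ and off-diagonal entries $\widetilde\beta_2,\dots,\widetilde\beta_n$, with $\widetilde\beta_j>0$ and $\widetilde\beta_j^2$ within the exponent range for $j=1,\dots,n$. Suppose that $V_k=[v_1,\dots,v_k]$ and $T_k$, $1\le k\le n$, are computed in floating point arithmetic using the Lanczos algorithm applied to $A$ and $b$, and that the system $T_ky_k=\|b\|e_1$ is solved numerically (in floating point arithmetic) using the $LDL^T$ factorization of $T_k$, giving the computed solution $\bar y_k$. Let $x_0=0$. Then, under the assumption $5\mathbf{u}\,\kappa(A)<1$, the computed CG approximate solution $\bar x_k=V_k\bar y_k$, $k>0$, satisfies $$\frac{\|x_k-\bar x_k\|}{\|x_k\|}\le\frac{5\mathbf{u}\,\kappa(A)}{1-5\mathbf{u}\,\kappa(A)},$$ where $x_k$ is the exact $k$th CG approximation for $Ax=b$ with initial guess $x_0=0$.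
   Context: **Floating point arithmetic.** $\mathbb{F}$ is the set of floating point numbers of an IEEE 754 binary format (e.g. binary64, binary32, binary16), with rounding to nearest. For $\alpha,\beta\in\mathbb{F}$ and a basic operation $\circ$ (addition, subtraction, multiplication, division; similarly the square root), $\mathrm{fl}(\alpha\circ\beta)$ is the floating point number nearest to the exact value; if the exact value is within the exponent range (no overflow or underflow), then $\mathrm{fl}(\alpha\circ\beta)=(\alpha\circ\beta)(1+\delta)$ with $|\delta|\le\mathbf{u}$, where $\mathbf{u}$ is the unit roundoff ($2\mathbf{u}$ is the machine epsilon). A positive real number is within the exponent range if it lies between the smallest positive normalized and the largest finite floating point number. No overflow or underflow is assumed to occur in the solution of the tridiagonal system. Inner products and matrix-vector products are evaluated as floating point sums of floating point products; the Euclidean norm is evaluated as the floating point square root of the floating point sum of the floating point squares of the entries. **Signed permutation matrix.** A permutation matrix in which the entries $1$ are replaced by $\pm1$. **Lanczos algorithm** (input: symmetric $A$, vector $v$; here $v=b$). Set $\beta_1=\|v\|$, $v_0=0$, $v_1=v/\beta_1$. For $i=1,2,\dots$: $w=Av_i-\beta_iv_{i-1}$; $\alpha_i=w^Tv_i$; $z=w-\alpha_iv_i$; $\beta_{i+1}=\|z\|$; if $\beta_{i+1}=0$ then stop; $v_{i+1}=z/\beta_{i+1}$. $T_k$ is the $k\times k$ symmetric tridiagonal matrix with diagonal $\alpha_1,\dots,\alpha_k$ and off-diagonal entries $\beta_2,\dots,\beta_k$. **$LDL^T$ solution.** $T_k=L_kD_kL_k^T$ with $L_k$ unit lower bidiagonal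 with subdiagonal entries $\ell_1,\dots,\ell_{k-1}$ and $D_k=\mathrm{diag}(d_1,\dots,d_k)$, computed by $d_1=\alpha_1$, $\ell_j=\beta_{j+1}/d_j$, $d_{j+1}=\alpha_{j+1}-\beta_{j+1}\ell_j$, $j=1,\dots,k-1$; then $T_ky_k=\|b\|e_1$ is solved by forward substitution with $L_k$, division by $D_k$, and back substitution with $L_k^T$, all in floating point arithmetic. **CG.** The exact conjugate gradient (CG) approximation $x_k$ (with $x_0=0$) is the vector in the Krylov subspace $\mathrm{span}\{b,Ab,\dots,A^{k-1}b\}$ minimizing $\|x-x_k\|_A=((x-x_k)^TA(x-x_k))^{1/2}$, where $Ax=b$. $\|\cdot\|$ is the Euclidean norm (or induced matrix norm) and $\kappa(A)=\|A\|\,\|A^{-1}\|$. *)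

theory Defs
  imports "HOL-Analysis.Analysis" "HOL-Library.Multiset"
begin

section \<open>Binary floating point formats\<close>

text \<open>
  A format is given by its precision p (the number of significand bits, the leading one included)
  and its maximal exponent emax; as in IEEE 754, the minimal exponent is 1 - emax.
  The bounds below are the parameters of binary16, the smallest IEEE 754 binary format.
\<close>

definition ieee_binary_format :: "nat \<Rightarrow> int \<Rightarrow> bool" where
  "ieee_binary_format p emax \<longleftrightarrow> 11 \<le> p \<and> 15 \<le> emax"

text \<open>The finite floating point numbers, subnormal numbers and zero included.\<close>

definition fp_numbers :: "nat \<Rightarrow> int \<Rightarrow> real set" where
  "fp_numbers p emax =
     {real_of_int m * 2 powi e | m e.
        \<bar>m\<bar> < 2 ^ p \<and> (1 - emax) - int p + 1 \<le> e \<and> e \<le> emax - int p + 1}"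

definition min_normal :: "int \<Rightarrow> real" where
  "min_normal emax = 2 powi (1 - emax)"

definition max_finite :: "nat \<Rightarrow> int \<Rightarrow> real" where
  "max_finite p emax = (2 - 2 powi (1 - int p)) * 2 powi emax"

definition unit_roundoff :: "nat \<Rightarrow> real" where
  "unit_roundoff p = 2 powi (- int p)"

definition in_exponent_range :: "nat \<Rightarrow> int \<Rightarrow> real \<Rightarrow> bool" where
  "in_exponent_range p emax x \<longleftrightarrow> min_normal emax \<le> x \<and> x \<le> max_finite p emax"

text \<open>
  The exact result x of an operation causes neither overflow nor underflow; an exact zero is
  not an underflow.
\<close>

definition no_over_underflow :: "nat \<Rightarrow> int \<Rightarrow> real \<Rightarrow> bool" where
  "no_over_underflow p emax x \<longleftrightarrow> x = 0 \<or> in_exponent_range p emax \<bar>x\<bar>"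

text \<open>
  Rounding to nearest with an arbitrary rule for ties. Beyond the largest finite number, where
  IEEE arithmetic may overflow to infinity, the value is left unspecified.
\<close>

definition round_to_nearest :: "nat \<Rightarrow> int \<Rightarrow> (real \<Rightarrow> real) \<Rightarrow> bool" where
  "round_to_nearest p emax fl \<longleftrightarrow>
     (\<forall>x. \<bar>x\<bar> \<le> max_finite p emax \<longrightarrow>
        fl x \<in> fp_numbers p emax \<and> (\<forall>y\<in>fp_numbers p emax. \<bar>fl x - x\<bar> \<le> \<bar>y - x\<bar>))"


section \<open>Floating point linear algebra\<close>

text \<open>
  The relation fl_sum fl M s says that s is the result of a floating point summation of the terms
  M in some order and with some bracketing. The operations built on it are
  relations for the same reason.
\<close>

inductive fl_sum :: "(real \<Rightarrow> real) \<Rightarrow> real multiset \<Rightarrow> real \<Rightarrow> bool" for fl where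
  single: "fl_sum fl {#x#} x"
| add: "fl_sum fl M s \<Longrightarrow> fl_sum fl N t \<Longrightarrow> fl_sum fl (M + N) (fl (s + t))"

definition fl_inner :: "(real \<Rightarrow> real) \<Rightarrow> real ^ 'n \<Rightarrow> real ^ 'n \<Rightarrow> real \<Rightarrow> bool" where
  "fl_inner fl x y s \<longleftrightarrow> fl_sum fl {# fl (x $ j * y $ j). j \<in># mset_set UNIV #} s"

definition fl_matvec :: "(real \<Rightarrow> real) \<Rightarrow> real ^ 'n ^ 'm \<Rightarrow> real ^ 'n \<Rightarrow> real ^ 'm \<Rightarrow> bool" where
  "fl_matvec fl A x y \<longleftrightarrow> (\<forall>i. fl_inner fl (A $ i) x (y $ i))"

definition fl_norm :: "(real \<Rightarrow> real) \<Rightarrow> real ^ 'n \<Rightarrow> real \<Rightarrow> bool" where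
  "fl_norm fl x r \<longleftrightarrow> (\<exists>s. fl_inner fl x x s \<and> r = fl (sqrt s))"

text \<open>The product of the matrix with columns v 1, ..., v k and the vector (y 1, ..., y k).\<close>

definition fl_combination ::
  "(real \<Rightarrow> real) \<Rightarrow> nat \<Rightarrow> (nat \<Rightarrow> real ^ 'n) \<Rightarrow> (nat \<Rightarrow> real) \<Rightarrow> real ^ 'n \<Rightarrow> bool" where
  "fl_combination fl k v y x \<longleftrightarrow>
     (\<forall>i. fl_sum fl {# fl (v j $ i * y j). j \<in># mset_set {1..k} #} (x $ i))"


section \<open>The Lanczos algorithm in floating point arithmetic\<close>

text \<open>
  The algorithm, run until v 1, ..., v k and the entries of the k by k tridiagonal matrix are
  known; alpha k is the last quantity needed. Step i is carried out only if the
  stopping test has not succeeded before; after that nothing is required.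
\<close>

definition fl_lanczos ::
  "(real \<Rightarrow> real) \<Rightarrow> real ^ 'n ^ 'n \<Rightarrow> real ^ 'n \<Rightarrow> nat \<Rightarrow>
   (nat \<Rightarrow> real) \<Rightarrow> (nat \<Rightarrow> real) \<Rightarrow> (nat \<Rightarrow> real ^ 'n) \<Rightarrow> bool" where
  "fl_lanczos fl A b k \<alpha> \<beta> v \<longleftrightarrow>
     fl_norm fl b (\<beta> 1) \<and> v 0 = 0 \<and> v 1 = (\<chi> r. fl (b $ r / \<beta> 1)) \<and>
     (\<forall>i\<in>{1..k}. (\<forall>j\<in>{2..i}. \<beta> j \<noteq> 0) \<longrightarrow>
        (\<exists>q w z.
           fl_matvec fl A (v i) q \<and>
           w = (\<chi> r. fl (q $ r - fl (\<beta> i * v (i - 1) $ r))) \<and>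
           fl_inner fl w (v i) (\<alpha> i) \<and>
           (i < k \<longrightarrow>
              z = (\<chi> r. fl (w $ r - fl (\<alpha> i * v i $ r))) \<and>
              fl_norm fl z (\<beta> (i + 1)) \<and>
              (\<beta> (i + 1) \<noteq> 0 \<longrightarrow> v (i + 1) = (\<chi> r. fl (z $ r / \<beta> (i + 1)))))))"


section \<open>Solution of the tridiagonal system in floating point arithmetic\<close>

text \<open>
  For T the symmetric tridiagonal k by k matrix with diagonal alpha 1, ..., alpha k and off-diagonal
  entries beta 2, ..., beta k, the system T y = c e (e the first unit vector) is solved from the factors l and d by forward
  substitution (giving z), division by the diagonal (giving g) and back substitution.
\<close>

definition fl_ldlt_solve ::
  "(real \<Rightarrow> real) \<Rightarrow> nat \<Rightarrow> (nat \<Rightarrow> real) \<Rightarrow> (nat \<Rightarrow> real) \<Rightarrow> real \<Rightarrow> (nat \<Rightarrow> real) \<Rightarrow> (nat \<Rightarrow> real) \<Rightarrow>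
   (nat \<Rightarrow> real) \<Rightarrow> (nat \<Rightarrow> real) \<Rightarrow> (nat \<Rightarrow> real) \<Rightarrow> bool" where
  "fl_ldlt_solve fl k \<alpha> \<beta> c l d z g y \<longleftrightarrow>
     d 1 = \<alpha> 1 \<and>
     (\<forall>j\<in>{1..<k}. l j = fl (\<beta> (j + 1) / d j) \<and>
                  d (j + 1) = fl (\<alpha> (j + 1) - fl (\<beta> (j + 1) * l j))) \<and>
     z 1 = c \<and>
     (\<forall>j\<in>{1..<k}. z (j + 1) = fl (0 - fl (l j * z j))) \<and>
     (\<forall>j\<in>{1..k}. g j = fl (z j / d j)) \<and>
     y k = g k \<and>
     (\<forall>j\<in>{1..<k}. y j = fl (g j - fl (l j * y (j + 1))))"

text \<open>The exact values that are rounded in the course of this computation.\<close>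

definition ldlt_exact_results ::
  "(real \<Rightarrow> real) \<Rightarrow> nat \<Rightarrow> (nat \<Rightarrow> real) \<Rightarrow> (nat \<Rightarrow> real) \<Rightarrow> (nat \<Rightarrow> real) \<Rightarrow> (nat \<Rightarrow> real) \<Rightarrow>
   (nat \<Rightarrow> real) \<Rightarrow> (nat \<Rightarrow> real) \<Rightarrow> (nat \<Rightarrow> real) \<Rightarrow> real set" where
  "ldlt_exact_results fl k \<alpha> \<beta> l d z g y =
     (\<Union>j\<in>{1..<k}.
        {\<beta> (j + 1) / d j, \<beta> (j + 1) * l j, \<alpha> (j + 1) - fl (\<beta> (j + 1) * l j),
         l j * z j, 0 - fl (l j * z j),
         l j * y (j + 1), g j - fl (l j * y (j + 1))}) \<union>
     (\<Union>j\<in>{1..k}. {z j / d j})"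


section \<open>Exact linear algebra\<close>

definition fp_matrix :: "nat \<Rightarrow> int \<Rightarrow> real ^ 'n ^ 'm \<Rightarrow> bool" where
  "fp_matrix p emax M \<longleftrightarrow> (\<forall>i j. M $ i $ j \<in> fp_numbers p emax)"

definition sym_pos_def :: "real ^ 'n ^ 'n \<Rightarrow> bool" where
  "sym_pos_def A \<longleftrightarrow> transpose A = A \<and> (\<forall>x. x \<noteq> 0 \<longrightarrow> 0 < x \<bullet> (A *v x))"

definition signed_permutation_matrix :: "real ^ 'n ^ 'n \<Rightarrow> bool" where
  "signed_permutation_matrix P \<longleftrightarrow>
     (\<exists>\<pi> s. bij \<pi> \<and> (\<forall>j. s j = 1 \<or> s j = - 1) \<and> P = (\<chi> i j. if i = \<pi> j then s j else 0))"

text \<open>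
  The index type carries no order, so the numbering ix of the coordinates by 1, ..., CARD('n) is
  explicit. The off-diagonal entry beta j sits in the positions (j - 1, j) and (j, j - 1).
\<close>

definition sym_tridiagonal ::
  "(nat \<Rightarrow> 'n) \<Rightarrow> (nat \<Rightarrow> real) \<Rightarrow> (nat \<Rightarrow> real) \<Rightarrow> real ^ 'n ^ 'n \<Rightarrow> bool" where
  "sym_tridiagonal ix \<alpha> \<beta> T \<longleftrightarrow>
     (\<forall>i\<in>{1..CARD('n)}. \<forall>j\<in>{1..CARD('n)}.
        T $ ix i $ ix j =
          (if i = j then \<alpha> i else if j = i + 1 then \<beta> j else if i = j + 1 then \<beta> i else 0))"

definition cond_number :: "real ^ 'n ^ 'n \<Rightarrow> real" where
  "cond_number A = onorm ((*v) A) * onorm ((*v) (matrix_inv A))"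

definition krylov_space :: "real ^ 'n ^ 'n \<Rightarrow> real ^ 'n \<Rightarrow> nat \<Rightarrow> (real ^ 'n) set" where
  "krylov_space A b k = span ((\<lambda>i. ((*v) A ^^ i) b) ` {..<k})"

definition energy_norm :: "real ^ 'n ^ 'n \<Rightarrow> real ^ 'n \<Rightarrow> real" where
  "energy_norm A x = sqrt (x \<bullet> (A *v x))"

text \<open>With the initial guess 0; x is the exact solution of A x = b.\<close>

definition cg_approximation ::
  "real ^ 'n ^ 'n \<Rightarrow> real ^ 'n \<Rightarrow> nat \<Rightarrow> real ^ 'n \<Rightarrow> bool" where
  "cg_approximation A b k xk \<longleftrightarrow>
     (\<exists>x. A *v x = b \<and>
          is_arg_min (\<lambda>y. energy_norm A (x - y)) (\<lambda>y. y \<in> krylov_space A b k) xk)"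

end

theory Submission imports Defs begin

text \<open>
  In the signed unit vectors that form the columns of P, the matrix is tridiagonal and b is a
  multiple of the first column. The exact Lanczos vectors are these columns, and the floating
  point algorithm finds exactly them, with the entries of T as coefficients: the vectors have a
  single nonzero entry, so sums involve no rounding and products only signs. The one exception is
  a norm, the square root of a rounded square, and in base 2 the root undoes the rounding
  (\<open>fl_sqrt_fl_square\<close>, \<open>fl_lanczos_exact\<close>). Consequently the whole
  error of the computed approximation comes from the solution of the tridiagonal system.

  The computed solution y of that system satisfies, row by row, |T y - c e| \<le> 5 u T |y|, where
  T has nonnegative entries (\<open>ldlt_residual\<close>). To first order the off-diagonal
  entries of T are perturbed by at most 4 u relatively. A diagonal entry \<alpha> is the sum of
  the pivot before its rounding and of the computed product of \<beta> and the multiplier. The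
  perturbation is 3 u for the pivot and 5 u for the product, and the terms of second order in the
  latter would exceed the bound 5 u \<alpha>. They are absorbed by the unused 2 u of the pivot,
  because the pivot cannot be small. The pivots before rounding are exact pivots of a matrix that
  differs from T by relative changes of the off-diagonal entries of at most 8/5 u, so they are at
  least the minimum of its quadratic form on unit vectors. The perturbation lowers that minimum by
  at most 4/5 u times the norm of A, and 5 u \<kappa>(A) < 1 says that the minimum of the
  unperturbed form exceeds 5 u times this norm (\<open>perturbed_pivot_lower_bound\<close>). The
  same bound shows that the factorization has positive pivots.

  Finally, the residual of the exact approximation is orthogonal to the Krylov space
  (\<open>cg_residual_orthogonal\<close>), which is spanned by the first k columns. Hence the
  error w lies in that space, and its squared energy norm is at most 5 u times the norm of A times
  the norms of w and of the computed approximation (\<open>residual_error_bound\<close>). Since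
  the squared energy norm is at least the squared norm of w divided by the norm of the inverse of
  A, the error is at most 5 u \<kappa>(A) relative to the computed approximation, and the
  denominator of the claim comes from passing to the exact one
  (\<open>relative_error_from_computed\<close>).
\<close>

section \<open>Rounding to nearest\<close>

lemma binade_exists:
  fixes x :: real
  assumes "0 < x"
  obtains t :: int where "2 powi t \<le> x" "x < 2 powi (t + 1)"
proof
  let ?t = "\<lfloor>log 2 x\<rfloor>"
  have pow: "(2::real) powi i = 2 powr real_of_int i" for i
    by (simp add: powr_real_of_int')
  show "2 powi ?t \<le> x"
    unfolding pow using assms by (simp add: le_log_iff [symmetric])
  show "x < 2 powi (?t + 1)"
    unfolding pow using assms by (simp only: log_less_iff [symmetric]) linarith
qed

lemma powi_less_exponent:
  fixes a b :: int
  shows "(2::real) powi a < 2 powi b \<longleftrightarrow> a < b"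
proof
  assume "(2::real) powi a < 2 powi b"
  then show "a < b"
    using power_int_increasing [of b a "2::real"] by (cases "a < b") auto
qed (auto intro: power_int_strict_increasing)

lemma powi_two_add: "(2::real) powi (a + b) = 2 powi a * 2 powi b"
  by (simp add: power_int_add)

locale nearest_rounding =
  fixes p :: nat and emax :: int and fl :: "real \<Rightarrow> real"
  assumes format: "ieee_binary_format p emax"
    and rounding: "round_to_nearest p emax fl"
begin

abbreviation "F \<equiv> fp_numbers p emax"
abbreviation "u \<equiv> unit_roundoff p"

lemma p_ge: "11 \<le> p" and emax_ge: "15 \<le> emax"
  using format by (auto simp: ieee_binary_format_def)

lemma u_eq: "u = 1 / 2 ^ p"
  by (simp add: unit_roundoff_def power_int_minus field_simps)

lemma u_pos: "0 < u"
  by (simp add: u_eq)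

lemma u_le: "u \<le> 1 / 2048"
proof -
  have "(2::real) ^ 11 \<le> 2 ^ p"
    using p_ge by (intro power_increasing) auto
  then show ?thesis
    by (simp add: u_eq field_simps)
qed

lemma max_finite_eq: "max_finite p emax = (2 ^ p - 1) * 2 powi (emax - int p + 1)"
proof -
  define a q r :: real where "a = 2 powi (emax - int p + 1)"
    and "q = 2 powi (int p - 1)" and "r = 2 powi (1 - int p)"
  have 1: "2 powi emax = a * q" and 2: "r * q = 1" and 3: "2 ^ p = 2 * q"
    using powi_two_add [of 1 "int p - 1"]
    by (simp_all add: a_def q_def r_def powi_two_add [symmetric])
  have "max_finite p emax = (2 * q - r * q) * a"
    unfolding max_finite_def 1 r_def by (simp add: algebra_simps)
  then show ?thesis
    unfolding 2 3 a_def by simp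
qed

lemma max_finite_less: "max_finite p emax < 2 powi (emax + 1)"
  unfolding max_finite_def by (simp add: powi_two_add algebra_simps)

lemma one_le_max_finite: "1 \<le> max_finite p emax"
proof -
  have *: "(1::real) \<le> 2 ^ p - 1"
    using u_le by (simp add: u_eq field_simps)
  have "2 powi (emax - int p + 1) * (2::real) ^ p = 2 powi (emax + 1)"
    using powi_two_add [of "emax - int p + 1" "int p"] by simp
  moreover have "(2::real) powi 1 \<le> 2 powi (emax + 1)"
    using emax_ge by (intro power_int_increasing) auto
  moreover have "2 ^ p \<le> 2 * ((2::real) ^ p - 1)"
    using * by (simp add: algebra_simps)
  then have "2 ^ p * 2 powi (emax - int p + 1) \<le> 2 * ((2::real) ^ p - 1) * 2 powi (emax - int p + 1)"
    by (intro mult_right_mono) auto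
  ultimately show ?thesis
    unfolding max_finite_eq by (simp add: algebra_simps)
qed

lemma F_I:
  assumes "\<bar>m\<bar> < 2 ^ p" "2 - emax - int p \<le> e" "e \<le> emax - int p + 1"
  shows "real_of_int m * 2 powi e \<in> F"
  using assms unfolding fp_numbers_def by fastforce

lemma F_uminus: "x \<in> F \<Longrightarrow> - x \<in> F"
  unfolding fp_numbers_def by (clarsimp, rule_tac x="-m" in exI, auto)

lemma zero_in_F: "0 \<in> F"
  using F_I [of 0 "2 - emax - int p"] emax_ge by simp

lemma power_two_in_F:
  assumes "1 - emax \<le> t" "t \<le> emax"
  shows "2 powi t \<in> F"
proof -
  have "real_of_int (2 ^ (p - 1)) * 2 powi (t - int p + 1) = 2 powi (int (p - 1) + (t - int p + 1))"
    unfolding powi_two_add by simp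
  also have "int (p - 1) + (t - int p + 1) = t"
    using p_ge by simp
  finally show ?thesis
    using F_I [of "2 ^ (p - 1)" "t - int p + 1"] assms p_ge by simp
qed

lemma one_in_F: "1 \<in> F"
  using power_two_in_F [of 0] emax_ge by simp

lemma F_bound:
  assumes "x \<in> F"
  shows "\<bar>x\<bar> \<le> max_finite p emax"
proof -
  obtain m e where x: "x = real_of_int m * 2 powi e" and m: "\<bar>m\<bar> < 2 ^ p"
      and e: "e \<le> emax - int p + 1"
    using assms by (auto simp: fp_numbers_def)
  have "\<bar>m\<bar> \<le> 2 ^ p - 1"
    using m by linarith
  then have "real_of_int \<bar>m\<bar> \<le> real_of_int (2 ^ p - 1)"
    by (subst of_int_le_iff)
  then have "\<bar>real_of_int m\<bar> \<le> 2 ^ p - 1"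
    by simp
  moreover have "(2::real) powi e \<le> 2 powi (emax - int p + 1)"
    using e by (intro power_int_increasing) auto
  ultimately have "\<bar>real_of_int m\<bar> * 2 powi e \<le> (2 ^ p - 1) * 2 powi (emax - int p + 1)"
    by (intro mult_mono) auto
  then show ?thesis
    by (simp add: x max_finite_eq abs_mult)
qed

lemma fl_in_F: "\<bar>x\<bar> \<le> max_finite p emax \<Longrightarrow> fl x \<in> F"
  and fl_nearest: "\<bar>x\<bar> \<le> max_finite p emax \<Longrightarrow> y \<in> F \<Longrightarrow> \<bar>fl x - x\<bar> \<le> \<bar>y - x\<bar>"
  using rounding by (auto simp: round_to_nearest_def)

lemma fl_exact: "x \<in> F \<Longrightarrow> fl x = x"
  using fl_nearest [of x x] F_bound [of x] by simp

text \<open>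
  In the binade starting at 2 powi t the floating point numbers are spaced by 2 u 2 powi t, hence
  one of them is at distance at most u 2 powi t.
\<close>

lemma close_in_F:
  assumes t: "2 powi t \<le> x" "x < 2 powi (t + 1)" and range: "1 - emax \<le> t" "t \<le> emax"
    and x: "x \<le> max_finite p emax"
  obtains y where "y \<in> F" "\<bar>y - x\<bar> \<le> u * 2 powi t"
proof -
  \<comment> \<open>Round the significand; it may round up to \<open>2 ^ p\<close>, the start of the next binade.\<close>
  define e where "e = t - int p + 1"
  define m where "m = round (x / 2 powi e)"
  let ?y = "real_of_int m * 2 powi e"
  have "2 powi e * (2::real) ^ p = 2 powi (e + int p)"
    unfolding powi_two_add by simp
  then have pe: "2 powi e * (2::real) ^ p = 2 * 2 powi t"
    by (simp add: e_def powi_two_add)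
  have "\<bar>real_of_int m - x / 2 powi e\<bar> \<le> 1 / 2"
    unfolding m_def by (rule of_int_round_abs_le)
  then have "\<bar>real_of_int m - x / 2 powi e\<bar> * 2 powi e \<le> 1 / 2 * 2 powi e"
    by (intro mult_right_mono) auto
  also have "\<bar>real_of_int m - x / 2 powi e\<bar> * 2 powi e = \<bar>?y - x\<bar>"
  proof -
    have "?y - x = (real_of_int m - x / 2 powi e) * 2 powi e"
      by (simp add: left_diff_distrib)
    then show ?thesis
      by (simp add: abs_mult)
  qed
  also have "1 / 2 * 2 powi e = u * 2 powi t"
    using pe by (simp add: u_eq field_simps)
  finally have close: "\<bar>?y - x\<bar> \<le> u * 2 powi t" .
  have "0 < x"
    using t(1) by (rule less_le_trans [rotated]) simp
  have m0: "0 \<le> m"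
    unfolding m_def using \<open>0 < x\<close> by (simp add: round_def)
  have scaled: "x / 2 powi e < real_of_int (2 ^ p)"
    using t(2) pe by (simp add: divide_less_eq powi_two_add mult.commute)
  have m_le: "m \<le> 2 ^ p"
    using round_mono [of "x / 2 powi e" "real_of_int (2 ^ p)"] scaled
    unfolding m_def by (metis less_eq_real_def round_of_int)
  show thesis
  proof (cases "m = 2 ^ p")
    case False
    then have "?y \<in> F"
      using m_le m0 range unfolding e_def by (intro F_I) auto
    then show thesis
      using close that by blast
  next
    case True
    have "t < emax"
    proof (rule ccontr)
      assume "\<not> t < emax"
      then have "t = emax"
        using range by simp
      then have "x / 2 powi e \<le> real_of_int (2 ^ p - 1)"
        using x by (simp add: max_finite_eq e_def divide_le_eq)
      then have "m \<le> 2 ^ p - 1"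
        unfolding m_def by (metis round_mono round_of_int)
      with True show False by simp
    qed
    moreover have "?y = 2 powi (t + 1)"
      using pe by (simp add: True powi_two_add mult.commute)
    ultimately have "?y \<in> F"
      using range power_two_in_F [of "t + 1"] by simp
    then show thesis
      using close that by blast
  qed
qed

text \<open>
  By the spacing, the error is at most u times the start of the binade of x. For the first bound,
  fl x cannot fall below that start. For the second, the start is itself a floating point number,
  so the error is also at most the distance of x from it.
\<close>

lemma fl_error:
  assumes x: "in_exponent_range p emax \<bar>x\<bar>"
  shows "\<bar>fl x - x\<bar> \<le> u * \<bar>fl x\<bar>" and "\<bar>fl x - x\<bar> * (1 + u) \<le> u * \<bar>x\<bar>"
proof -
  have lo: "2 powi (1 - emax) \<le> \<bar>x\<bar>" and hi: "\<bar>x\<bar> \<le> max_finite p emax"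
    using x by (auto simp: in_exponent_range_def min_normal_def)
  have "0 < \<bar>x\<bar>"
    using lo by (rule less_le_trans [rotated]) simp
  then obtain t where t: "2 powi t \<le> \<bar>x\<bar>" "\<bar>x\<bar> < 2 powi (t + 1)"
    by (rule binade_exists)
  have "(2::real) powi (1 - emax) < 2 powi (t + 1)" "(2::real) powi t < 2 powi (emax + 1)"
    using lo hi t max_finite_less by linarith+
  then have range: "1 - emax \<le> t" "t \<le> emax"
    unfolding powi_less_exponent by linarith+
  obtain y where y: "y \<in> F" "\<bar>y - \<bar>x\<bar>\<bar> \<le> u * 2 powi t"
    using close_in_F [OF t range hi] by blast
  define s where "s = sgn x"
  have xs: "x = s * \<bar>x\<bar>" and s: "s = 1 \<or> s = -1"
    using \<open>0 < \<bar>x\<bar>\<close> unfolding s_def by (auto simp: sgn_if)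
  have "s * y \<in> F" "s * 2 powi t \<in> F"
    using s F_uminus [OF y(1)] y(1) F_uminus [OF power_two_in_F [OF range]] power_two_in_F [OF range]
    by (elim disjE; simp)+
  moreover have "\<bar>s * y - x\<bar> = \<bar>y - \<bar>x\<bar>\<bar>" "\<bar>s * 2 powi t - x\<bar> = \<bar>x\<bar> - 2 powi t"
    using s xs t(1) by auto
  ultimately have e1: "\<bar>fl x - x\<bar> \<le> u * 2 powi t" and e2: "\<bar>fl x - x\<bar> \<le> \<bar>x\<bar> - 2 powi t"
    using fl_nearest [OF hi] y(2) by force+
  have "2 powi t \<le> \<bar>fl x\<bar>"
    using e2 by linarith
  then have "u * 2 powi t \<le> u * \<bar>fl x\<bar>"
    using u_pos by (intro mult_left_mono) auto
  with e1 show "\<bar>fl x - x\<bar> \<le> u * \<bar>fl x\<bar>"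
    by linarith
  have "u * \<bar>fl x - x\<bar> \<le> u * (\<bar>x\<bar> - 2 powi t)"
    using e2 u_pos by (intro mult_left_mono) auto
  with e1 show "\<bar>fl x - x\<bar> * (1 + u) \<le> u * \<bar>x\<bar>"
    by (simp add: algebra_simps)
qed

text \<open>
  Above 2 powi t, floating point numbers are integer multiples of the spacing in the binade
  starting at 2 powi t, since the larger binades have coarser spacings.
\<close>

lemma F_normalized:
  assumes c: "c \<in> F" and t: "2 powi t \<le> c"
  obtains m :: int where "c = real_of_int m * 2 powi (t - int p + 1)"
proof -
  obtain m e where x: "c = real_of_int m * 2 powi e" and m: "\<bar>m\<bar> < 2 ^ p"
    using c by (auto simp: fp_numbers_def)
  have "\<bar>real_of_int m\<bar> < 2 ^ p"
    using m by (metis of_int_abs of_int_less_iff of_int_numeral of_int_power)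
  then have "real_of_int m * 2 powi e < 2 ^ p * 2 powi e"
    by (intro mult_strict_right_mono) (linarith, simp)
  also have "\<dots> = 2 powi (int p + e)"
    unfolding powi_two_add by simp
  finally have "(2::real) powi t < 2 powi (int p + e)"
    using t by (simp add: x)
  then have te: "t - int p + 1 \<le> e"
    unfolding powi_less_exponent by simp
  have "(2::real) powi e = 2 powi ((e - (t - int p + 1)) + (t - int p + 1))"
    by simp
  also have "\<dots> = 2 powi (e - (t - int p + 1)) * 2 powi (t - int p + 1)"
    by (rule powi_two_add)
  also have "(2::real) powi (e - (t - int p + 1)) = 2 ^ nat (e - (t - int p + 1))"
    using te by (simp add: power_int_def)
  finally have "c = real_of_int (m * 2 ^ nat (e - (t - int p + 1))) * 2 powi (t - int p + 1)"
    by (simp add: x)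
  then show thesis
    by (rule that)
qed

text \<open>
  The strict inequality matters: below 2 powi t the spacing halves, so 2 powi t itself has a
  neighbour at half the distance.
\<close>

lemma F_isolated:
  assumes c: "c \<in> F" "2 powi t < c" and f: "f \<in> F" "f \<noteq> c"
  shows "2 powi (t - int p + 1) \<le> \<bar>f - c\<bar>"
proof (cases "2 powi t \<le> f")
  case True
  obtain m where m: "c = real_of_int m * 2 powi (t - int p + 1)"
    using F_normalized [OF c(1)] c(2) by (metis less_imp_le)
  obtain m' where m': "f = real_of_int m' * 2 powi (t - int p + 1)"
    using F_normalized [OF f(1) True] by blast
  have "m' \<noteq> m"
    using f(2) m m' by auto
  then have "1 \<le> \<bar>m' - m\<bar>"
    by linarith
  then have "1 \<le> \<bar>real_of_int m' - real_of_int m\<bar>"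
    by linarith
  then have "1 * 2 powi (t - int p + 1) \<le> \<bar>real_of_int m' - real_of_int m\<bar> * 2 powi (t - int p + 1)"
    by (intro mult_right_mono) auto
  also have "\<dots> = \<bar>f - c\<bar>"
    by (simp add: m m' left_diff_distrib [symmetric] abs_mult)
  finally show ?thesis
    by simp
next
  case False
  obtain m where m: "c = real_of_int m * 2 powi (t - int p + 1)"
    using F_normalized [OF c(1)] c(2) by (metis less_imp_le)
  have "(2::real) powi t = 2 powi (int (p - 1) + (t - int p + 1))"
    using p_ge by simp
  also have "\<dots> = real_of_int (2 ^ (p - 1)) * 2 powi (t - int p + 1)"
    unfolding powi_two_add by simp
  finally have tt: "(2::real) powi t = real_of_int (2 ^ (p - 1)) * 2 powi (t - int p + 1)" .
  have "2 ^ (p - 1) < m"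
  proof -
    have "real_of_int (2 ^ (p - 1)) * 2 powi (t - int p + 1) < real_of_int m * 2 powi (t - int p + 1)"
      using c(2) m tt by simp
    then have "real_of_int (2 ^ (p - 1)) < real_of_int m"
      by (rule mult_right_less_imp_less) simp
    then show ?thesis
      by (subst (asm) of_int_less_iff)
  qed
  then have "1 \<le> real_of_int m - real_of_int (2 ^ (p - 1))"
    by linarith
  then have "1 * 2 powi (t - int p + 1) \<le> (real_of_int m - real_of_int (2 ^ (p - 1))) * 2 powi (t - int p + 1)"
    by (intro mult_right_mono) auto
  also have "\<dots> = c - 2 powi t"
    by (simp add: m tt left_diff_distrib)
  finally show ?thesis
    using False by linarith
qed

text \<open>
  In base 2 the square root undoes the rounding of a square. The relative error of the rounded
  square is halved by the root, so the root deviates from c by less than half a unit in the last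
  place of c. Powers of two need a separate argument, because the spacing of the floating point
  numbers is smaller below them; their squares are exact.
\<close>

lemma fl_sqrt_fl_square:
  assumes c: "c \<in> F" "0 < c" and range: "in_exponent_range p emax (c\<^sup>2)"
  shows "fl (sqrt (fl (c\<^sup>2))) = c"
proof -
  obtain t where t: "2 powi t \<le> c" "c < 2 powi (t + 1)"
    using c(2) by (rule binade_exists)
  have lo: "2 powi (1 - emax) \<le> c\<^sup>2" and hi: "c\<^sup>2 \<le> max_finite p emax"
    using range by (auto simp: in_exponent_range_def min_normal_def)
  show ?thesis
  proof (cases "c = 2 powi t")
    case True
    then have c2: "c\<^sup>2 = 2 powi (2 * t)"
      using powi_two_add [of t t] by (simp add: power2_eq_square)
    have "(2::real) powi (2 * t) < 2 powi (emax + 1)" "(2::real) powi (1 - emax) < 2 powi (2 * t + 1)"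
    proof -
      show "(2::real) powi (2 * t) < 2 powi (emax + 1)"
        using hi max_finite_less by (simp add: c2)
      have "(2::real) powi (2 * t) < 2 powi (2 * t + 1)"
        by (simp add: powi_less_exponent)
      with lo show "(2::real) powi (1 - emax) < 2 powi (2 * t + 1)"
        by (simp add: c2)
    qed
    then have "c\<^sup>2 \<in> F"
      unfolding c2 powi_less_exponent by (intro power_two_in_F) auto
    then show ?thesis
      using c by (simp add: fl_exact real_sqrt_abs)
  next
    case False
    then have tc: "2 powi t < c"
      using t(1) by simp
    define s where "s = fl (c\<^sup>2)"
    define y where "y = sqrt s"
    have err: "\<bar>s - c\<^sup>2\<bar> * (1 + u) \<le> u * c\<^sup>2"
      using fl_error(2) [of "c\<^sup>2"] range by (simp add: s_def)
    have "\<bar>s - c\<^sup>2\<bar> \<le> \<bar>s - c\<^sup>2\<bar> * (1 + u)"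
      using u_pos by (simp add: algebra_simps)
    with err have err': "\<bar>s - c\<^sup>2\<bar> \<le> u * c\<^sup>2"
      by linarith
    have s_ge: "(1 - u) * c\<^sup>2 \<le> s"
      using err' by (simp add: algebra_simps)
    have s_pos: "0 < s"
    proof -
      have "0 < (1 - u) * c\<^sup>2"
        using u_le c(2) by (intro mult_pos_pos) auto
      then show ?thesis
        using s_ge by linarith
    qed
    have y_pos: "0 < y" and y2: "y\<^sup>2 = s"
      using s_pos by (auto simp: y_def)
    have "(1 - 2 * u)\<^sup>2 < 1 - u"
    proof -
      have "u * (4 * u) < u * 3"
        using u_pos u_le by (intro mult_strict_left_mono) auto
      then show ?thesis
        by (simp add: power2_eq_square algebra_simps)
    qed
    then have "((1 - 2 * u) * c)\<^sup>2 < (1 - u) * c\<^sup>2"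
      using c(2) by (simp add: power_mult_distrib)
    also have "\<dots> \<le> y\<^sup>2"
      using s_ge y2 by simp
    finally have y_ge: "(1 - 2 * u) * c < y"
      using y_pos power_less_imp_less_base by fastforce
    let ?e = "2 powi (t - int p + 1) :: real"
    have uc: "u * c \<le> (1 - u) * ?e"
    proof -
      have pe: "?e * (2::real) ^ p = 2 powi (t + 1)"
        using powi_two_add [of "t - int p + 1" "int p"] by simp
      obtain m where m: "c = real_of_int m * ?e"
        using F_normalized [OF c(1) t(1)] by blast
      have "real_of_int m * ?e < real_of_int (2 ^ p) * ?e"
        using t(2) m pe by (simp add: mult.commute)
      then have "real_of_int m < real_of_int (2 ^ p)"
        by (rule mult_right_less_imp_less) simp
      then have "m < 2 ^ p"
        by (subst (asm) of_int_less_iff)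
      then have "m \<le> 2 ^ p - 1"
        by simp
      then have "real_of_int m \<le> real_of_int (2 ^ p - 1)"
        by (subst of_int_le_iff)
      then have "real_of_int m * ?e \<le> (2 ^ p - 1) * ?e"
        by (intro mult_right_mono) auto
      then show ?thesis
        unfolding m using p_ge by (simp add: u_eq field_simps)
    qed
    have dist: "2 * \<bar>c - y\<bar> < ?e"
    proof -
      have "\<bar>c - y\<bar> * (c + y) = \<bar>s - c\<^sup>2\<bar>"
      proof -
        have "\<bar>c - y\<bar> * (c + y) = \<bar>(c - y) * (c + y)\<bar>"
          using c(2) y_pos by (simp add: abs_mult)
        also have "(c - y) * (c + y) = c\<^sup>2 - s"
          by (simp add: y2 [symmetric] power2_eq_square algebra_simps)
        finally show ?thesis by simp
      qed
      then have "2 * \<bar>c - y\<bar> * (c + y) \<le> 2 * (u * c) * c"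
        using err' by (simp add: power2_eq_square algebra_simps)
      also have "\<dots> \<le> 2 * ((1 - u) * ?e) * c"
        using mult_right_mono [OF uc, of "2 * c"] c(2) by (simp add: mult_ac)
      also have "\<dots> = ?e * (2 * (1 - u) * c)"
        by simp
      also have "\<dots> < ?e * (c + y)"
        using y_ge by (intro mult_strict_left_mono) (auto simp: algebra_simps)
      finally show ?thesis
        using c(2) y_pos by (simp add: mult_less_cancel_right)
    qed
    have "s \<le> max_finite p emax"
      using F_bound [OF fl_in_F [of "c\<^sup>2"]] hi by (simp add: s_def)
    moreover have "y \<le> max 1 s"
    proof -
      have "1 * s \<le> max 1 s * max 1 s"
        using s_pos by (intro mult_mono) auto
      then show ?thesis
        unfolding y_def by (intro real_le_lsqrt) (auto simp: power2_eq_square)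
    qed
    ultimately have y_le: "\<bar>y\<bar> \<le> max_finite p emax"
      using one_le_max_finite y_pos by simp
    have "\<bar>fl y - y\<bar> \<le> \<bar>c - y\<bar>"
      using fl_nearest [OF y_le c(1)] .
    then have "\<bar>fl y - c\<bar> \<le> 2 * \<bar>c - y\<bar>"
      using abs_triangle_ineq [of "fl y - y" "y - c"] by (simp add: abs_minus_commute)
    then have "\<bar>fl y - c\<bar> < ?e"
      using dist by (rule le_less_trans)
    then have "fl y = c"
      using F_isolated [OF c(1) tc fl_in_F [OF y_le]] by fastforce
    then show ?thesis
      by (simp add: y_def s_def)
  qed
qed

end

section \<open>Pivots of a tridiagonal matrix\<close>

text \<open>
  The quadratic form of the leading block of order m of the symmetric tridiagonal matrix with
  diagonal entries \<alpha> 1, \<alpha> 2, ... and off-diagonal entries \<beta> 2, \<beta> 3, ....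
\<close>

definition tridiagonal_form :: "(nat \<Rightarrow> real) \<Rightarrow> (nat \<Rightarrow> real) \<Rightarrow> nat \<Rightarrow> (nat \<Rightarrow> real) \<Rightarrow> real" where
  "tridiagonal_form \<alpha> \<beta> m x =
     (\<Sum>i=1..m. \<alpha> i * (x i)\<^sup>2) + 2 * (\<Sum>i=1..<m. \<beta> (i + 1) * (x i * x (i + 1)))"

text \<open>
  Changing the sign of every other component of a vector changes the sign of the off-diagonal part
  of the form. Hence the off-diagonal part is bounded by half the upper bound of the form if the
  form is nonnegative.
\<close>

lemma tridiagonal_form_alternating:
  "tridiagonal_form \<alpha> \<beta> m (\<lambda>i. (-1) ^ i * x i) =
     (\<Sum>i=1..m. \<alpha> i * (x i)\<^sup>2) - 2 * (\<Sum>i=1..<m. \<beta> (i + 1) * (x i * x (i + 1)))"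
proof -
  have "(- 1) ^ i * x i * ((- 1) ^ (i + 1) * x (i + 1)) = - (x i * x (i + 1))" for i
    by (simp add: power_add [symmetric])
  then show ?thesis
    unfolding tridiagonal_form_def
    by (simp only: power_mult_distrib power_even_eq [symmetric]) (simp add: sum_negf)
qed

text \<open>
  The pivots r 1, ..., r m are those of a matrix with the same diagonal whose squared off-diagonal
  entries q i * r i exceed those of the given matrix by a factor of at most (1 + a) squared. Up to
  signs, the vector w of the proof is annihilated by the first m - 1 rows of that matrix, whose
  form at w is therefore r m times the square of w m; the given form at w is at least \<mu> times
  the squared norm of w.
\<close>

lemma perturbed_pivot_lower_bound:
  fixes \<alpha> \<beta> r q :: "nat \<Rightarrow> real"
  assumes m: "1 \<le> m"
    and lower: "\<And>x. \<mu> * (\<Sum>i=1..m. (x i)\<^sup>2) \<le> tridiagonal_form \<alpha> \<beta> m x"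
    and upper: "\<And>x. tridiagonal_form \<alpha> \<beta> m x \<le> M * (\<Sum>i=1..m. (x i)\<^sup>2)"
    and a: "0 \<le> a" "a * M / 2 \<le> \<mu>" and \<mu>: "0 \<le> \<mu>"
    and r1: "r 1 = \<alpha> 1"
    and recurrence: "\<And>i. i \<in> {1..<m} \<Longrightarrow> r (i + 1) = \<alpha> (i + 1) - q i"
    and pos: "\<And>i. i \<in> {1..<m} \<Longrightarrow> 0 < r i" "\<And>i. i \<in> {1..<m} \<Longrightarrow> 0 < q i"
      "\<And>i. i \<in> {1..<m} \<Longrightarrow> 0 < \<beta> (i + 1)"
    and perturbed: "\<And>i. i \<in> {1..<m} \<Longrightarrow> q i * r i \<le> (\<beta> (i + 1) * (1 + a))\<^sup>2"
  shows "\<mu> - a * M / 2 \<le> r m"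
proof -
  define w where "w = (\<lambda>i. \<Prod>j=1..<i. sqrt (r j / q j))"
  have w_pos: "0 < w i" if "i \<le> m" for i
    unfolding w_def using pos that by (intro prod_pos) (auto intro!: divide_pos_pos)
  have w_Suc: "w (i + 1) = w i * sqrt (r i / q i)" if "i \<in> {1..<m}" for i
    using that unfolding w_def by (simp add: prod.atLeastLessThan_Suc)
  have w_sq: "q i * (w (i + 1))\<^sup>2 = r i * (w i)\<^sup>2" if i: "i \<in> {1..<m}" for i
    using pos(1,2) [OF i] unfolding w_Suc [OF i] by (simp add: power_mult_distrib less_imp_le)
  have offdiag: "r i * (w i)\<^sup>2 \<le> \<beta> (i + 1) * (1 + a) * (w i * w (i + 1))" if i: "i \<in> {1..<m}" for i
  proof -
    have "sqrt (q i * r i) \<le> \<beta> (i + 1) * (1 + a)"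
      using perturbed [OF i] pos(3) [OF i] a by (intro real_le_lsqrt) auto
    then have "sqrt (q i * r i) * (w i * w (i + 1)) \<le> \<beta> (i + 1) * (1 + a) * (w i * w (i + 1))"
      using w_pos i by (intro mult_right_mono) (auto simp: less_imp_le)
    moreover have "sqrt (q i * r i) * (w i * w (i + 1)) = r i * (w i)\<^sup>2"
      using pos(1,2) [OF i] unfolding w_Suc [OF i]
      by (simp add: real_sqrt_mult real_sqrt_divide power2_eq_square)
    ultimately show ?thesis by simp
  qed
  define D where "D = (\<Sum>i=1..m. \<alpha> i * (w i)\<^sup>2)"
  define B where "B = (\<Sum>i=1..<m. \<beta> (i + 1) * (w i * w (i + 1)))"
  define N where "N = (\<Sum>i=1..m. (w i)\<^sup>2)"
  have "(\<Sum>i=1..n. \<alpha> i * (w i)\<^sup>2) - 2 * (\<Sum>i=1..<n. r i * (w i)\<^sup>2) = r n * (w n)\<^sup>2"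
    if "1 \<le> n" "n \<le> m" for n
    using that
  proof (induction n rule: dec_induct)
    case base
    then show ?case using r1 by simp
  next
    case (step n)
    have \<alpha>: "\<alpha> (Suc n) = q n + r (Suc n)" and "q n * (w (Suc n))\<^sup>2 = r n * (w n)\<^sup>2"
      using recurrence [of n] w_sq [of n] step by auto
    then show ?case
      using step by (simp add: \<alpha> algebra_simps)
  qed
  then have "D - 2 * (\<Sum>i=1..<m. r i * (w i)\<^sup>2) = r m * (w m)\<^sup>2"
    using m by (simp add: D_def)
  moreover have "(\<Sum>i=1..<m. r i * (w i)\<^sup>2) \<le> (1 + a) * B"
    unfolding B_def sum_distrib_left using offdiag by (intro sum_mono) (simp add: mult_ac)
  ultimately have top: "D - 2 * ((1 + a) * B) \<le> r m * (w m)\<^sup>2"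
    by linarith
  have N: "(\<Sum>i=1..m. ((-1) ^ i * w i)\<^sup>2) = N"
    by (simp add: N_def power_mult_distrib power_even_eq [symmetric])
  have alt: "tridiagonal_form \<alpha> \<beta> m (\<lambda>i. (-1) ^ i * w i) = D - 2 * B"
    by (simp add: tridiagonal_form_alternating D_def B_def)
  have "\<mu> * N \<le> D - 2 * B"
    using lower [of "\<lambda>i. (-1) ^ i * w i"] unfolding N alt .
  moreover have "0 \<le> N"
    unfolding N_def by (intro sum_nonneg) auto
  then have "0 \<le> \<mu> * N"
    using \<mu> by simp
  moreover have "D + 2 * B \<le> M * N"
    using upper [of w] by (simp add: tridiagonal_form_def D_def B_def N_def)
  ultimately have "4 * B \<le> M * N"
    by linarith
  then have "a * (4 * B) \<le> a * (M * N)"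
    using a by (intro mult_left_mono) auto
  then have "(\<mu> - a * M / 2) * N \<le> r m * (w m)\<^sup>2"
    using top \<open>\<mu> * N \<le> D - 2 * B\<close> by (simp add: algebra_simps)
  moreover have "(w m)\<^sup>2 \<le> N"
    unfolding N_def using m by (intro member_le_sum) auto
  then have "(\<mu> - a * M / 2) * (w m)\<^sup>2 \<le> (\<mu> - a * M / 2) * N"
    using a by (intro mult_left_mono) auto
  ultimately have "(\<mu> - a * M / 2) * (w m)\<^sup>2 \<le> r m * (w m)\<^sup>2"
    by linarith
  then show ?thesis
    using w_pos [of m] by (simp add: mult_le_cancel_right)
qed

section \<open>Rounding errors in the solution of the tridiagonal system\<close>

text \<open>The i-th component of the product of the tridiagonal matrix of order k with the vector y.\<close>

definition tridiagonal_mult ::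
  "(nat \<Rightarrow> real) \<Rightarrow> (nat \<Rightarrow> real) \<Rightarrow> nat \<Rightarrow> (nat \<Rightarrow> real) \<Rightarrow> nat \<Rightarrow> real" where
  "tridiagonal_mult \<alpha> \<beta> k y i =
     (if i = 1 then 0 else \<beta> i * y (i - 1)) + \<alpha> i * y i
       + (if i = k then 0 else \<beta> (i + 1) * y (i + 1))"

lemma mult_between:
  fixes x y :: real
  assumes "a \<le> x" "x \<le> b" "c \<le> y" "y \<le> d" "0 \<le> a" "0 \<le> c"
  shows "a * c \<le> x * y" "x * y \<le> b * d"
  using assms by (auto intro!: mult_mono)

context nearest_rounding
begin

text \<open>
  The largest possible quotient of fl x and x. The quotient of x and fl x may reach 1 + u, which
  is larger by a term of second order. These terms matter: five factors 1 + u would exceed 1 + 5 *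
  u by 10 times the square of u, more than the pivots can absorb, whereas three factors
  \<open>round_up_factor\<close> and two factors 1 + u exceed it by about 7 times the square of u.
\<close>

definition round_up_factor :: real where
  "round_up_factor = (1 + 2 * u) / (1 + u)"

lemma round_up_factor_bounds: "1 \<le> round_up_factor" "round_up_factor \<le> 1 + u"
  unfolding round_up_factor_def using u_pos by (auto simp: field_simps)

lemma fl_factor:
  assumes "no_over_underflow p emax x"
  obtains f where "fl x = x * f" "1 - u \<le> f" "f \<le> round_up_factor"
proof (cases "x = 0")
  case True
  then show thesis
    using that [of 1] round_up_factor_bounds u_pos fl_exact [OF zero_in_F] by simp
next
  case False
  then have "\<bar>fl x - x\<bar> * (1 + u) \<le> u * \<bar>x\<bar>"
    using assms fl_error(2) by (simp add: no_over_underflow_def)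
  then have "\<bar>fl x - x\<bar> / \<bar>x\<bar> * (1 + u) \<le> u"
    using False by (simp add: divide_le_eq)
  moreover have "\<bar>fl x - x\<bar> / \<bar>x\<bar> = \<bar>fl x / x - 1\<bar>"
    using False by (simp add: abs_divide [symmetric] diff_divide_distrib)
  ultimately have "\<bar>fl x / x - 1\<bar> \<le> u / (1 + u)"
    using u_pos by (simp add: le_divide_eq)
  moreover have "u / (1 + u) \<le> u" "1 + u / (1 + u) = round_up_factor"
    unfolding round_up_factor_def using u_pos by (auto simp: field_simps)
  ultimately have "1 - u \<le> fl x / x" "fl x / x \<le> round_up_factor"
    by linarith+
  then show thesis
    using that [of "fl x / x"] False by simp
qed

lemma fl_factor_inverse:
  assumes "no_over_underflow p emax x"
  obtains f where "x = fl x * f" "1 - u \<le> f" "f \<le> 1 + u"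
proof (cases "x = 0")
  case True
  then show thesis
    using that [of 1] u_pos fl_exact [OF zero_in_F] by simp
next
  case False
  then have "\<bar>fl x - x\<bar> \<le> u * \<bar>fl x\<bar>"
    using assms fl_error(1) by (simp add: no_over_underflow_def)
  moreover have "fl x \<noteq> 0"
    using calculation False by auto
  ultimately have "\<bar>fl x - x\<bar> / \<bar>fl x\<bar> \<le> u"
    by (simp add: divide_le_eq)
  moreover have "\<bar>fl x - x\<bar> / \<bar>fl x\<bar> = \<bar>1 - x / fl x\<bar>"
    using \<open>fl x \<noteq> 0\<close> by (simp add: abs_divide [symmetric] diff_divide_distrib)
  ultimately have "1 - u \<le> x / fl x" "x / fl x \<le> 1 + u"
    by linarith+
  then show thesis
    using that [of "x / fl x"] \<open>fl x \<noteq> 0\<close> by simp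
qed

lemma fl_pos:
  assumes "no_over_underflow p emax x" "0 < x"
  shows "0 < fl x"
proof -
  obtain f where "fl x = x * f" "1 - u \<le> f"
    using fl_factor [OF assms(1)] by blast
  then show ?thesis
    using assms(2) u_le by simp
qed

lemma fl_result_in_F: "no_over_underflow p emax x \<Longrightarrow> fl x \<in> F"
  using one_le_max_finite
  by (intro fl_in_F) (auto simp: no_over_underflow_def in_exponent_range_def)

text \<open>
  The square root of a product of three factors is 1 + 3/2 u to first order; 8/5 leaves room for
  the rest.
\<close>

lemma pivot_growth:
  assumes "f \<le> round_up_factor" "1 - u \<le> f" "f' \<le> round_up_factor" "1 - u \<le> f'"
    and "g \<le> 1 + u" "1 - u \<le> g"
  shows "f * f' * g \<le> (1 + 8 / 5 * u)\<^sup>2"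
proof -
  have "f * f' \<le> round_up_factor * round_up_factor" "(1 - u) * (1 - u) \<le> f * f'"
    using assms u_le by (auto intro!: mult_between)
  then have "f * f' * g \<le> round_up_factor * round_up_factor * (1 + u)"
    using mult_between(2) [of "(1 - u) * (1 - u)" "f * f'" _ "1 - u" g] assms u_le by auto
  also have "\<dots> = (1 + 2 * u)\<^sup>2 / (1 + u)"
    unfolding round_up_factor_def using u_pos by (simp add: power2_eq_square)
  also have "\<dots> \<le> (1 + 8 / 5 * u)\<^sup>2"
  proof -
    have "(1 + 8 / 5 * u)\<^sup>2 * (1 + u) - (1 + 2 * u)\<^sup>2 = u / 5 + u * u * (44 / 25) + u * u * u * (64 / 25)"
      by (simp add: power2_eq_square field_simps)
    also have "0 \<le> \<dots>"
      using u_pos by simp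
    finally show ?thesis
      using u_pos by (simp add: divide_le_eq)
  qed
  finally show ?thesis .
qed

text \<open>
  The factors f1, f2 and f3 are quotients of a computed and an exact value, f4 and f5 quotients of
  an exact and a computed value. The products are those by which rounding multiplies the pivots,
  the off-diagonal entries (twice) and the computed products of off-diagonal entries and
  multipliers.
\<close>

lemma error_factors:
  fixes f1 f2 f3 f4 f5 :: real
  assumes f: "f1 \<le> round_up_factor" "1 - u \<le> f1" "f2 \<le> round_up_factor" "1 - u \<le> f2"
      "f3 \<le> round_up_factor" "1 - u \<le> f3" "f4 \<le> 1 + u" "1 - u \<le> f4" "f5 \<le> 1 + u" "1 - u \<le> f5"
  shows "f1 * f4 * f5 \<le> 1 + 3 * u + 2 * u\<^sup>2" (is ?A)
    and "1 - 5 * u \<le> f1 * f4 * f5" (is ?B)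
    and "\<bar>f1 * f2 * f4 - 1\<bar> \<le> 5 * u" (is ?C)
    and "\<bar>f1 * f2 * f4 * f5 - 1\<bar> \<le> 5 * u" (is ?D)
    and "1 - 5 * u \<le> f1 * f2 * f3 * f4 * f5" (is ?E)
    and "f1 * f2 * f3 * f4 * f5 \<le> 1 + 5 * u + 7 * u\<^sup>2 + u ^ 3" (is ?G)
proof -
  let ?R = round_up_factor and ?L = "1 - u" and ?U = "1 + u"
  have L: "0 \<le> ?L" "0 \<le> ?L * ?L" "0 \<le> ?L * ?L * ?L" "0 \<le> ?L * ?L * ?L * ?L"
    using u_le by (auto intro!: mult_nonneg_nonneg)
  have R: "?R * (1 + u) = 1 + 2 * u"
    unfolding round_up_factor_def using u_pos by simp
  have p145: "?L * ?L * ?L \<le> f1 * f4 * f5" "f1 * f4 * f5 \<le> ?R * ?U * ?U"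
    using mult_between [OF mult_between [of ?L f1 ?R ?L f4 ?U] f(10,9)] f L by auto
  have p12: "?L * ?L \<le> f1 * f2" "f1 * f2 \<le> ?R * ?R"
    using mult_between [of ?L f1 ?R ?L f2 ?R] f L by auto
  have p124: "?L * ?L * ?L \<le> f1 * f2 * f4" "f1 * f2 * f4 \<le> ?R * ?R * ?U"
    using mult_between [OF p12 f(8,7)] L by auto
  have p1245: "?L * ?L * ?L * ?L \<le> f1 * f2 * f4 * f5" "f1 * f2 * f4 * f5 \<le> ?R * ?R * ?U * ?U"
    using mult_between [OF p124 f(10,9)] L by auto
  have p123: "?L * ?L * ?L \<le> f1 * f2 * f3" "f1 * f2 * f3 \<le> ?R * ?R * ?R"
    using mult_between [OF p12 f(6,5)] L by auto
  have p1234: "?L * ?L * ?L * ?L \<le> f1 * f2 * f3 * f4" "f1 * f2 * f3 * f4 \<le> ?R * ?R * ?R * ?U"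
    using mult_between [OF p123 f(8,7)] L by auto
  have p12345: "?L * ?L * ?L * ?L * ?L \<le> f1 * f2 * f3 * f4 * f5"
    "f1 * f2 * f3 * f4 * f5 \<le> ?R * ?R * ?R * ?U * ?U"
    using mult_between [OF p1234 f(10,9)] L by auto
  have low: "1 - 5 * u \<le> ?L ^ n" if "n \<le> 5" for n
  proof -
    have "1 - 5 * u \<le> 1 + real n * (- u)"
      using that u_pos by simp
    also have "\<dots> \<le> (1 + (- u)) ^ n"
      using u_le by (intro Bernoulli_inequality) auto
    finally show ?thesis by simp
  qed
  have low': "1 - 5 * u \<le> ?L * ?L * ?L" "1 - 5 * u \<le> ?L * ?L * ?L * ?L" "1 - 5 * u \<le> ?L * ?L * ?L * ?L * ?L"
    using low [of 3] low [of 4] low [of 5] by (simp_all add: eval_nat_numeral mult_ac)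
  have up: "?R * ?R * ?U * ?U = (1 + 2 * u)\<^sup>2"
  proof -
    have "?R * ?R * ?U * ?U = (?R * ?U) * (?R * ?U)"
      by (simp only: mult_ac)
    then show ?thesis
      by (simp only: R power2_eq_square)
  qed
  have "u * (4 * u) \<le> u * 1"
    using u_pos u_le by (intro mult_left_mono) auto
  then have sq: "(1 + 2 * u)\<^sup>2 \<le> 1 + 5 * u"
    by (simp add: power2_eq_square algebra_simps)
  have "?R * ?R * ?U * 1 \<le> ?R * ?R * ?U * ?U"
    using u_pos round_up_factor_bounds by (intro mult_left_mono) auto
  then have up': "?R * ?R * ?U \<le> 1 + 5 * u"
    using up sq by simp
  have "?R * ?U * ?U = (1 + 2 * u) * ?U"
    by (simp add: R)
  then show ?A
    using p145 by (simp add: power2_eq_square algebra_simps)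
  show ?B ?E
    using p145 p12345 low' by linarith+
  show ?C
    using p124 low'(1) up' by linarith
  show ?D
    using p1245 low'(2) up sq by linarith
  have "?R * ?R * ?R * ?U * ?U = ?R * (1 + 2 * u)\<^sup>2"
    using up by (simp add: mult.assoc)
  also have "\<dots> = (1 + 2 * u) ^ 3 / (1 + u)"
    by (simp add: round_up_factor_def power2_eq_square power3_eq_cube)
  also have "\<dots> \<le> 1 + 5 * u + 7 * u\<^sup>2 + u ^ 3"
  proof -
    have "(1 + 5 * u + 7 * u\<^sup>2 + u ^ 3) * (1 + u) - (1 + 2 * u) ^ 3 = u ^ 4"
      by (simp add: eval_nat_numeral algebra_simps)
    also have "0 \<le> \<dots>"
      by simp
    finally show ?thesis
      using u_pos by (simp add: divide_le_eq)
  qed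
  finally show ?G
    using p12345 by linarith
qed

text \<open>
  Eliminating z and g from the computed quantities shows that y solves exactly a system whose
  entries are those of T up to the products of error factors above. On the diagonal, \<alpha> i is
  r i + q (i - 1) with r i the pivot before rounding and q (i - 1) the computed product of \<beta>
  i and the multiplier; the lower bound 21/5 u M for r i is 5 u M minus half of 8/5 u M.
\<close>

lemma ldlt_residual:
  assumes k: "1 \<le> k"
    and solve: "fl_ldlt_solve fl k \<alpha> \<beta> c l d z g y"
    and safe: "\<And>x. x \<in> ldlt_exact_results fl k \<alpha> \<beta> l d z g y \<Longrightarrow> no_over_underflow p emax x"
    and \<beta>_pos: "\<And>i. i \<in> {1..<k} \<Longrightarrow> 0 < \<beta> (i + 1)"
    and lower: "\<And>m x. m \<in> {1..k} \<Longrightarrow> \<mu> * (\<Sum>i=1..m. (x i)\<^sup>2) \<le> tridiagonal_form \<alpha> \<beta> m x"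
    and upper: "\<And>m x. m \<in> {1..k} \<Longrightarrow> tridiagonal_form \<alpha> \<beta> m x \<le> M * (\<Sum>i=1..m. (x i)\<^sup>2)"
    and M: "0 < M" "5 * u * M \<le> \<mu>"
    and i: "i \<in> {1..k}"
  shows "\<bar>tridiagonal_mult \<alpha> \<beta> k y i - (if i = 1 then c else 0)\<bar>
           \<le> 5 * u * tridiagonal_mult \<alpha> \<beta> k (\<lambda>j. \<bar>y j\<bar>) i"
proof -
  define q where "q j = fl (\<beta> (j + 1) * l j)" for j
  define r where "r j = (if j = 1 then \<alpha> 1 else \<alpha> j - q (j - 1))" for j
  have ldl: "l j = fl (\<beta> (j + 1) / d j)" "d (j + 1) = fl (r (j + 1))"
    "z (j + 1) = fl (0 - fl (l j * z j))" "y j = fl (g j - fl (l j * y (j + 1)))" if "j \<in> {1..<k}" for j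
    using solve that by (auto simp: fl_ldlt_solve_def q_def r_def)
  have d1: "d 1 = r 1" and z1: "z 1 = c" and yk: "y k = g k"
    using solve by (auto simp: fl_ldlt_solve_def r_def)
  have gj: "g j = fl (z j / d j)" if "j \<in> {1..k}" for j
    using solve that by (auto simp: fl_ldlt_solve_def)
  have safe': "no_over_underflow p emax (\<beta> (j + 1) / d j)" "no_over_underflow p emax (\<beta> (j + 1) * l j)"
    "no_over_underflow p emax (r (j + 1))" "no_over_underflow p emax (l j * z j)"
    "no_over_underflow p emax (l j * y (j + 1))" "no_over_underflow p emax (g j - fl (l j * y (j + 1)))"
    if "j \<in> {1..<k}" for j
  proof -
    have "r (j + 1) = \<alpha> (j + 1) - fl (\<beta> (j + 1) * l j)"
      using that by (simp add: r_def q_def)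
    then have "{\<beta> (j + 1) / d j, \<beta> (j + 1) * l j, r (j + 1), l j * z j, l j * y (j + 1),
        g j - fl (l j * y (j + 1))} \<subseteq> ldlt_exact_results fl k \<alpha> \<beta> l d z g y"
      unfolding ldlt_exact_results_def using that by (intro le_supI1 SUP_upper2 [OF that]) auto
    then show "no_over_underflow p emax (\<beta> (j + 1) / d j)" "no_over_underflow p emax (\<beta> (j + 1) * l j)"
      "no_over_underflow p emax (r (j + 1))" "no_over_underflow p emax (l j * z j)"
      "no_over_underflow p emax (l j * y (j + 1))" "no_over_underflow p emax (g j - fl (l j * y (j + 1)))"
      by (auto intro!: safe)
  qed
  have safe_z: "no_over_underflow p emax (z j / d j)" if "j \<in> {1..k}" for j
    by (rule safe, unfold ldlt_exact_results_def, rule UnI2, rule UN_I [OF that]) simp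

  \<comment> \<open>The first pivot is not rounded, so the factor 1 serves there.\<close>
  have d_r: "\<exists>f. d j = r j * f \<and> 1 - u \<le> f \<and> f \<le> round_up_factor"
    and r_d: "\<exists>f. r j = d j * f \<and> 1 - u \<le> f \<and> f \<le> 1 + u" if "j \<in> {1..k}" for j
  proof -
    have "j = 1 \<or> (j - 1 \<in> {1..<k} \<and> j = j - 1 + 1)"
      using that by auto
    then have "j = 1 \<or> (d j = fl (r j) \<and> no_over_underflow p emax (r j))"
      using ldl(2) [of "j - 1"] safe'(3) [of "j - 1"] by metis
    then show "\<exists>f. d j = r j * f \<and> 1 - u \<le> f \<and> f \<le> round_up_factor"
      "\<exists>f. r j = d j * f \<and> 1 - u \<le> f \<and> f \<le> 1 + u"
      using u_pos round_up_factor_bounds d1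
      by (auto elim: fl_factor fl_factor_inverse intro: exI [of _ 1]) (metis fl_factor fl_factor_inverse)+
  qed

  define a where "a = 8 / 5 * u"
  have a: "0 \<le> a" "a * M / 2 \<le> \<mu>" "0 \<le> \<mu>" "\<mu> - a * M / 2 \<ge> 21 / 5 * u * M" "0 < u * M"
  proof -
    have "0 < u * M" "5 * (u * M) \<le> \<mu>" "a * M / 2 = 4 / 5 * (u * M)"
      using M u_pos by (auto simp: a_def)
    then show "a * M / 2 \<le> \<mu>" "0 \<le> \<mu>" "\<mu> - a * M / 2 \<ge> 21 / 5 * u * M" "0 < u * M"
      by linarith+
    show "0 \<le> a"
      using u_pos by (simp add: a_def)
  qed
  have pivots: "21 / 5 * u * M \<le> r j \<and> 0 < d j \<and> (j < k \<longrightarrow> 0 < l j \<and> 0 < q j \<and> q j * r j \<le> (\<beta> (j + 1) * (1 + a))\<^sup>2)"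
    if "j \<in> {1..k}" for j
    using that
  proof (induction j rule: less_induct)
    case (less j)
    have "\<mu> - a * M / 2 \<le> r j"
    proof (rule perturbed_pivot_lower_bound [where \<alpha> = \<alpha> and \<beta> = \<beta> and q = q])
      fix i assume "i \<in> {1..<j}"
      then have i: "i < j" "i \<in> {1..k}" "i < k"
        using less.prems by auto
      show "r (i + 1) = \<alpha> (i + 1) - q i"
        using i by (simp add: r_def)
      show "0 < r i" "0 < q i" "q i * r i \<le> (\<beta> (i + 1) * (1 + a))\<^sup>2"
        using less.IH [OF i(1,2)] i(3) a(5) by auto
      show "0 < \<beta> (i + 1)"
        using i \<beta>_pos by simp
    qed (use less.prems lower upper a in \<open>auto simp: r_def\<close>)
    then have r: "21 / 5 * u * M \<le> r j"
      using a(4) by linarith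
    then have r_pos: "0 < r j"
      using a(5) by linarith
    obtain f where f: "d j = r j * f" "1 - u \<le> f"
      using d_r [OF less.prems] by blast
    then have d_pos: "0 < d j"
      using r_pos u_le by simp
    have "0 < l j \<and> 0 < q j \<and> q j * r j \<le> (\<beta> (j + 1) * (1 + a))\<^sup>2" if "j < k"
    proof -
      have j: "j \<in> {1..<k}"
        using that less.prems by simp
      have l_pos: "0 < l j"
        using fl_pos [OF safe'(1) [OF j]] ldl(1) [OF j] \<beta>_pos [OF j] d_pos by simp
      have q_pos: "0 < q j"
        using fl_pos [OF safe'(2) [OF j]] \<beta>_pos [OF j] l_pos by (simp add: q_def)
      obtain f1 where f1: "l j = \<beta> (j + 1) / d j * f1" "1 - u \<le> f1" "f1 \<le> round_up_factor"
        using fl_factor [OF safe'(1) [OF j]] ldl(1) [OF j] by metis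
      obtain f2 where f2: "q j = \<beta> (j + 1) * l j * f2" "1 - u \<le> f2" "f2 \<le> round_up_factor"
        using fl_factor [OF safe'(2) [OF j]] unfolding q_def by metis
      obtain f3 where f3: "r j = d j * f3" "1 - u \<le> f3" "f3 \<le> 1 + u"
        using r_d [OF less.prems] by blast
      have "q j * r j = (\<beta> (j + 1))\<^sup>2 * (f1 * f2 * f3)"
        using d_pos unfolding f2(1) f1(1) f3(1) by (simp add: power2_eq_square)
      also have "\<dots> \<le> (\<beta> (j + 1))\<^sup>2 * (1 + a)\<^sup>2"
        unfolding a_def using f1 f2 f3 by (intro mult_left_mono pivot_growth) auto
      finally show ?thesis
        using l_pos q_pos by (simp add: power_mult_distrib)
    qed
    then show ?case
      using r d_pos by blast
  qed
  have r_ge: "21 / 5 * u * M \<le> r j" and d_pos: "0 < d j" if "j \<in> {1..k}" for j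
    using pivots [OF that] by auto
  have l_pos: "0 < l j" and q_pos: "0 < q j" if "j \<in> {1..<k}" for j
    using pivots [of j] that by auto

  have back_subst: "\<exists>f f'. g j = y j * f + l j * y (j + 1) * f' \<and> 1 - u \<le> f \<and> f \<le> 1 + u
                \<and> 1 - u \<le> f' \<and> f' \<le> round_up_factor" if j: "j \<in> {1..<k}" for j
  proof -
    obtain f where f: "g j - fl (l j * y (j + 1)) = y j * f" "1 - u \<le> f" "f \<le> 1 + u"
      using fl_factor_inverse [OF safe'(6) [OF j]] ldl(4) [OF j] by metis
    obtain f' where f': "fl (l j * y (j + 1)) = l j * y (j + 1) * f'" "1 - u \<le> f'" "f' \<le> round_up_factor"
      using fl_factor [OF safe'(5) [OF j]] by metis
    show ?thesis
      using f f' by (intro exI [of _ f] exI [of _ f']) (auto simp: algebra_simps)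
  qed
  have diag: "\<exists>f. z j = d j * g j * f \<and> 1 - u \<le> f \<and> f \<le> 1 + u" if j: "j \<in> {1..k}" for j
  proof -
    obtain f where "z j / d j = g j * f" "1 - u \<le> f" "f \<le> 1 + u"
      using fl_factor_inverse [OF safe_z [OF j]] gj [OF j] by metis
    then show ?thesis
      using d_pos [OF j] by (intro exI [of _ f]) (auto simp: field_simps)
  qed
  have dl: "\<exists>f. l j * d j = \<beta> (j + 1) * f \<and> 1 - u \<le> f \<and> f \<le> round_up_factor" if j: "j \<in> {1..<k}" for j
  proof -
    obtain f where "l j = \<beta> (j + 1) / d j * f" "1 - u \<le> f" "f \<le> round_up_factor"
      using fl_factor [OF safe'(1) [OF j]] ldl(1) [OF j] by metis
    then show ?thesis
      using d_pos [of j] j by (intro exI [of _ f]) (auto simp: field_simps)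
  qed

  have upper_part: "\<exists>f h. z j = r j * f * y j + (if j = k then 0 else \<beta> (j + 1) * h * y (j + 1))
      \<and> 1 - 5 * u \<le> f \<and> f \<le> 1 + 3 * u + 2 * u\<^sup>2 \<and> \<bar>h - 1\<bar> \<le> 5 * u" if j: "j \<in> {1..k}" for j
  proof -
    obtain f1 where f1: "z j = d j * g j * f1" "1 - u \<le> f1" "f1 \<le> 1 + u"
      using diag [OF j] by blast
    obtain f2 where f2: "d j = r j * f2" "1 - u \<le> f2" "f2 \<le> round_up_factor"
      using d_r [OF j] by blast
    show ?thesis
    proof (cases "j = k")
      case True
      have "z j = r j * (f2 * f1 * 1) * y j"
        unfolding f1(1) f2(1) using yk True by simp
      then show ?thesis
        using True error_factors(1,2) [of f2 1 1 f1 1] f1 f2 u_pos round_up_factor_bounds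
        by (intro exI [of _ "f2 * f1 * 1"] exI [of _ 1]) auto
    next
      case False
      then have j': "j \<in> {1..<k}"
        using j by simp
      obtain f3 f4 where f3: "g j = y j * f3 + l j * y (j + 1) * f4" "1 - u \<le> f3" "f3 \<le> 1 + u"
          "1 - u \<le> f4" "f4 \<le> round_up_factor"
        using back_subst [OF j'] by blast
      obtain f5 where f5: "l j * d j = \<beta> (j + 1) * f5" "1 - u \<le> f5" "f5 \<le> round_up_factor"
        using dl [OF j'] by blast
      have "z j = d j * f1 * f3 * y j + (l j * d j) * f1 * f4 * y (j + 1)"
        unfolding f1(1) f3(1) by (simp add: algebra_simps)
      also have "\<dots> = r j * (f2 * f1 * f3) * y j + \<beta> (j + 1) * (f4 * f5 * f1) * y (j + 1)"
        unfolding f5(1) unfolding f2(1) by simp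
      finally show ?thesis
        using False error_factors(1,2) [of f2 1 1 f1 f3] error_factors(3) [of f4 f5 1 f1 1]
          f1 f2 f3 f5 u_pos round_up_factor_bounds
        by (intro exI [of _ "f2 * f1 * f3"] exI [of _ "f4 * f5 * f1"]) auto
    qed
  qed
  \<comment> \<open>Subtraction from zero is exact, so only the product is rounded in the forward substitution.\<close>
  have lower_part: "\<exists>f h. - z (j + 1) = \<beta> (j + 1) * h * y j + q j * f * y (j + 1)
      \<and> 1 - 5 * u \<le> f \<and> f \<le> 1 + 5 * u + 7 * u\<^sup>2 + u ^ 3 \<and> \<bar>h - 1\<bar> \<le> 5 * u"
    if j: "j \<in> {1..<k}" for j
  proof -
    have "- z (j + 1) = fl (l j * z j)"
      using ldl(3) [OF j] fl_exact [OF F_uminus [OF fl_result_in_F [OF safe'(4) [OF j]]]] by simp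
    then obtain f0 where f0: "- z (j + 1) = l j * z j * f0" "1 - u \<le> f0" "f0 \<le> round_up_factor"
      using fl_factor [OF safe'(4) [OF j]] by metis
    obtain f1 where f1: "z j = d j * g j * f1" "1 - u \<le> f1" "f1 \<le> 1 + u"
      using diag [of j] j by auto
    obtain f2 where f2: "\<beta> (j + 1) * l j = q j * f2" "1 - u \<le> f2" "f2 \<le> 1 + u"
      using fl_factor_inverse [OF safe'(2) [OF j]] unfolding q_def by metis
    obtain f3 f4 where f3: "g j = y j * f3 + l j * y (j + 1) * f4" "1 - u \<le> f3" "f3 \<le> 1 + u"
        "1 - u \<le> f4" "f4 \<le> round_up_factor"
      using back_subst [OF j] by blast
    obtain f5 where f5: "l j * d j = \<beta> (j + 1) * f5" "1 - u \<le> f5" "f5 \<le> round_up_factor"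
      using dl [OF j] by blast
    have "- z (j + 1) = (l j * d j) * f0 * f1 * f3 * y j + (l j * d j) * l j * f0 * f1 * f4 * y (j + 1)"
      unfolding f0(1) f1(1) f3(1) by (simp add: algebra_simps)
    also have "\<dots> = \<beta> (j + 1) * (f0 * f5 * f1 * f3) * y j + (\<beta> (j + 1) * l j) * (f0 * f5 * f4 * f1) * y (j + 1)"
      unfolding f5(1) by simp
    also have "\<dots> = \<beta> (j + 1) * (f0 * f5 * f1 * f3) * y j + q j * (f0 * f5 * f4 * f1 * f2) * y (j + 1)"
      unfolding f2(1) by simp
    finally show ?thesis
      using error_factors(4) [of f0 f5 1 f1 f3] error_factors(5,6) [of f0 f5 f4 f1 f2]
        f0 f1 f2 f3 f5 u_pos round_up_factor_bounds
      by (intro exI [of _ "f0 * f5 * f4 * f1 * f2"] exI [of _ "f0 * f5 * f1 * f3"]) auto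
  qed

  obtain f h where fh: "z i = r i * f * y i + (if i = k then 0 else \<beta> (i + 1) * h * y (i + 1))"
      "1 - 5 * u \<le> f" "f \<le> 1 + 3 * u + 2 * u\<^sup>2" "\<bar>h - 1\<bar> \<le> 5 * u"
    using upper_part [OF i] by blast
  have r_pos: "0 < r i"
    using r_ge [OF i] a(5) by linarith
  define X where "X = (if i = k then 0 else \<beta> (i + 1) * (1 - h) * y (i + 1))"
  define Y where "Y = (if i = k then 0 else \<beta> (i + 1) * \<bar>y (i + 1)\<bar>)"
  have next_term: "\<bar>X\<bar> \<le> 5 * u * Y"
  proof (cases "i = k")
    case False
    then have \<beta>i: "0 < \<beta> (i + 1)"
      using \<beta>_pos [of i] i by simp
    then have "\<beta> (i + 1) * \<bar>y (i + 1)\<bar> * \<bar>h - 1\<bar> \<le> \<beta> (i + 1) * \<bar>y (i + 1)\<bar> * (5 * u)"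
      using fh(4) by (intro mult_left_mono) auto
    then show ?thesis
      using \<beta>i False by (simp add: X_def Y_def abs_mult abs_minus_commute mult_ac)
  qed (simp add: X_def Y_def)
  show ?thesis
  proof (cases "i = 1")
    case True
    have "u\<^sup>2 \<le> u"
      using u_pos u_le by (simp add: power2_eq_square)
    then have "\<bar>1 - f\<bar> \<le> 5 * u"
      using fh u_pos by linarith
    then have "r i * \<bar>y i\<bar> * \<bar>1 - f\<bar> \<le> r i * \<bar>y i\<bar> * (5 * u)"
      using r_pos by (intro mult_left_mono) auto
    then have "\<bar>\<alpha> 1 * (1 - f) * y 1\<bar> \<le> 5 * u * (\<alpha> 1 * \<bar>y 1\<bar>)"
      using r_pos by (simp add: True r_def abs_mult mult_ac)
    moreover have "tridiagonal_mult \<alpha> \<beta> k y i - c = \<alpha> 1 * (1 - f) * y 1 + X"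
      using fh(1) z1 True
      by (cases "i = k") (simp_all add: tridiagonal_mult_def r_def X_def algebra_simps)
    moreover have "tridiagonal_mult \<alpha> \<beta> k (\<lambda>j. \<bar>y j\<bar>) i = \<alpha> 1 * \<bar>y 1\<bar> + Y"
      by (simp add: tridiagonal_mult_def True Y_def)
    ultimately show ?thesis
      using next_term True abs_triangle_ineq [of "\<alpha> 1 * (1 - f) * y 1" X] by (simp add: distrib_left)
  next
    case False
    define j where "j = i - 1"
    have ij: "i = j + 1" and j: "j \<in> {1..<k}" "i - Suc 0 = j"
      using False i by (auto simp: j_def)
    obtain f' h' where fh': "- z i = \<beta> i * h' * y j + q j * f' * y i"
        "1 - 5 * u \<le> f'" "f' \<le> 1 + 5 * u + 7 * u\<^sup>2 + u ^ 3" "\<bar>h' - 1\<bar> \<le> 5 * u"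
      using lower_part [OF j(1)] unfolding ij by blast
    have \<alpha>: "\<alpha> i = r i + q j"
      using False by (simp add: r_def j_def)
    have \<beta>i: "0 < \<beta> i"
      using \<beta>_pos [OF j(1)] ij by simp
    have prev_term: "\<bar>\<beta> i * (1 - h') * y j\<bar> \<le> 5 * u * (\<beta> i * \<bar>y j\<bar>)"
    proof -
      have "\<beta> i * \<bar>y j\<bar> * \<bar>h' - 1\<bar> \<le> \<beta> i * \<bar>y j\<bar> * (5 * u)"
        using fh'(4) \<beta>i by (intro mult_left_mono) auto
      then show ?thesis
        using \<beta>i by (simp add: abs_mult abs_minus_commute mult_ac)
    qed
    have \<alpha>_le: "\<alpha> i \<le> M"
    proof -
      have "(\<Sum>n=1..i. \<alpha> n * (if n = i then 1 else 0)\<^sup>2) = \<alpha> i"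
        using i by (subst sum.remove [of _ i]) auto
      moreover have "(\<Sum>n=1..i. (if n = i then 1 else 0 :: real)\<^sup>2) = 1"
        using i by (subst sum.remove [of _ i]) auto
      ultimately show ?thesis
        using upper [OF i, of "\<lambda>n. if n = i then 1 else 0"] by (simp add: tridiagonal_form_def)
    qed
    have "\<bar>r i * (f - 1) + q j * (f' - 1)\<bar> \<le> 5 * u * \<alpha> i"
    proof -
      have lo: "- (5 * u) * r i \<le> r i * (f - 1)" "- (5 * u) * q j \<le> q j * (f' - 1)"
        using fh(2) fh'(2) mult_left_mono [of "- (5 * u)" "f - 1" "r i"]
          mult_left_mono [of "- (5 * u)" "f' - 1" "q j"] r_pos q_pos [OF j(1)] by (auto simp: mult_ac)
      have hi: "r i * (f - 1) \<le> r i * (3 * u + 2 * u\<^sup>2)"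
        "q j * (f' - 1) \<le> q j * (5 * u + 7 * u\<^sup>2 + u ^ 3)"
        using fh(3) fh'(3) r_pos q_pos [OF j(1)] by (auto intro!: mult_left_mono)
      \<comment> \<open>The second order terms of the product are absorbed by the pivot.\<close>
      have "q j * (7 * u\<^sup>2 + u ^ 3) \<le> M * (7 * u\<^sup>2 + u ^ 3)"
        using \<alpha>_le \<alpha> r_pos u_pos by (intro mult_right_mono) auto
      also have "\<dots> \<le> (21 / 5 * u * M) * (2 * u - 2 * u\<^sup>2)"
      proof -
        have "0 \<le> M * u\<^sup>2 * (7 / 5 - 47 / 5 * u)"
          using M u_le by (intro mult_nonneg_nonneg) auto
        then show ?thesis
          by (simp add: power2_eq_square power3_eq_cube algebra_simps)
      qed
      also have "\<dots> \<le> r i * (2 * u - 2 * u\<^sup>2)"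
        using r_ge [OF i] u_pos u_le
        by (intro mult_right_mono) (auto simp: power2_eq_square)
      finally have "q j * (5 * u + 7 * u\<^sup>2 + u ^ 3) + r i * (3 * u + 2 * u\<^sup>2) \<le> 5 * u * \<alpha> i"
        by (simp add: \<alpha> algebra_simps)
      moreover have "- (5 * u) * r i + - (5 * u) * q j = - (5 * u * \<alpha> i)"
        by (simp add: \<alpha> algebra_simps)
      ultimately show ?thesis
        using lo hi by linarith
    qed
    then have "\<bar>r i * (f - 1) + q j * (f' - 1)\<bar> * \<bar>y i\<bar> \<le> 5 * u * \<alpha> i * \<bar>y i\<bar>"
      by (rule mult_right_mono) simp
    then have diag_term: "\<bar>(r i * (f - 1) + q j * (f' - 1)) * y i\<bar> \<le> 5 * u * (\<alpha> i * \<bar>y i\<bar>)"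
      by (simp add: abs_mult mult_ac)
    have row: "tridiagonal_mult \<alpha> \<beta> k y i = \<beta> i * (1 - h') * y j
        - (r i * (f - 1) + q j * (f' - 1)) * y i + X"
    proof -
      have "tridiagonal_mult \<alpha> \<beta> k y i
          = \<beta> i * y j + (r i + q j) * y i + (if i = k then 0 else \<beta> (i + 1) * y (i + 1))"
        using False by (simp add: tridiagonal_mult_def \<alpha> j(2))
      then show ?thesis
        using fh(1) fh'(1) by (cases "i = k") (simp_all add: X_def algebra_simps)
    qed
    have abs_row: "tridiagonal_mult \<alpha> \<beta> k (\<lambda>j. \<bar>y j\<bar>) i = \<beta> i * \<bar>y j\<bar> + \<alpha> i * \<bar>y i\<bar> + Y"
      using False by (simp add: Y_def tridiagonal_mult_def j(2))
    have "\<bar>A - B + C\<bar> \<le> a + b + c" if "\<bar>A\<bar> \<le> a" "\<bar>B\<bar> \<le> b" "\<bar>C\<bar> \<le> c" for A B C a b c :: real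
      using that by linarith
    from this [OF prev_term diag_term next_term] show ?thesis
      unfolding row abs_row using False by (simp add: distrib_left)
  qed
qed

end

section \<open>Exactness of the Lanczos algorithm\<close>

context nearest_rounding
begin

text \<open>
  In any order and bracketing, every addition has a zero operand; zeros are added exactly and the
  nonzero term is reproduced because it is a floating point number.
\<close>

lemma fl_sum_at_most_one_nonzero:
  assumes "fl_sum fl M s" and "set_mset M \<subseteq> F" and "size (filter_mset (\<lambda>x. x \<noteq> 0) M) \<le> 1"
  shows "s = sum_mset M \<and> s \<in> F"
  using assms
proof (induction rule: fl_sum.induct)
  case (single x)
  then show ?case by simp
next
  case (add M s N t)
  have zero: "sum_mset K = 0" if "filter_mset (\<lambda>x. x \<noteq> 0) K = {#}" for K :: "real multiset"
    using that by (intro sum_mset.neutral) (auto simp: filter_mset_eq_conv)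
  have sizes: "size (filter_mset (\<lambda>x. x \<noteq> 0) M) + size (filter_mset (\<lambda>x. x \<noteq> 0) N) \<le> 1"
    using add.prems by simp
  then have "s = sum_mset M \<and> s \<in> F" "t = sum_mset N \<and> t \<in> F"
    using add by auto
  moreover have "filter_mset (\<lambda>x. x \<noteq> 0) M = {#} \<or> filter_mset (\<lambda>x. x \<noteq> 0) N = {#}"
    using sizes by (metis One_nat_def add_is_1 le_less less_one size_eq_0_iff_empty add_is_0)
  then have "sum_mset M = 0 \<or> sum_mset N = 0"
    using zero by blast
  ultimately show ?case
    by (auto simp: fl_exact)
qed

lemma fl_sum_single_term:
  assumes sum: "fl_sum fl {# f j. j \<in># mset_set S #} s" and S: "finite S" "r \<in> S"
    and f: "f r \<in> F" "\<And>j. j \<in> S \<Longrightarrow> j \<noteq> r \<Longrightarrow> f j = 0"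
  shows "s = f r"
proof -
  let ?N = "{# f j. j \<in># mset_set (S - {r}) #}"
  have M: "{# f j. j \<in># mset_set S #} = add_mset (f r) ?N"
    using S by (simp add: mset_set.remove)
  have zeros: "set_mset ?N \<subseteq> {0}"
    using S f(2) by auto
  have "filter_mset (\<lambda>x. x \<noteq> 0) ?N = {#}" and N: "sum_mset ?N = 0"
    using S f(2) by (auto simp: filter_mset_eq_conv intro!: sum_mset.neutral)
  then have "size (filter_mset (\<lambda>x. x \<noteq> 0) (add_mset (f r) ?N)) \<le> 1"
    by (simp only: filter_mset_add_mset) simp
  moreover have "set_mset (add_mset (f r) ?N) \<subseteq> F"
    using zeros f(1) zero_in_F by auto
  ultimately have "s = sum_mset (add_mset (f r) ?N)"
    using fl_sum_at_most_one_nonzero [OF sum [unfolded M]] by blast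
  then show ?thesis
    using N by simp
qed

lemma fl_inner_axis:
  assumes "fl_inner fl x (c *\<^sub>R axis r 1) t" and "c = 1 \<or> c = -1" and "x $ r \<in> F"
  shows "t = c * x $ r"
proof -
  have "c * x $ r \<in> F"
    using assms(2,3) F_uminus by auto
  then have "t = fl (x $ r * (c *\<^sub>R axis r 1) $ r)"
    by (intro fl_sum_single_term [OF assms(1) [unfolded fl_inner_def], of r])
      (auto simp: axis_def fl_exact zero_in_F mult.commute)
  then show ?thesis
    using \<open>c * x $ r \<in> F\<close> by (simp add: axis_def fl_exact mult.commute)
qed

lemma fl_norm_axis:
  assumes "fl_norm fl (c *\<^sub>R axis r 1) t" and "\<bar>c\<bar> \<in> F" "c \<noteq> 0" and "in_exponent_range p emax (c\<^sup>2)"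
  shows "t = \<bar>c\<bar>"
proof -
  obtain a where a: "fl_inner fl (c *\<^sub>R axis r 1) (c *\<^sub>R axis r 1) a" and t: "t = fl (sqrt a)"
    using assms(1) by (auto simp: fl_norm_def)
  have "fl (c\<^sup>2) \<in> F"
    using assms(4) by (intro fl_result_in_F) (auto simp: no_over_underflow_def)
  then have "a = fl ((c *\<^sub>R axis r 1) $ r * (c *\<^sub>R axis r 1) $ r)"
    by (intro fl_sum_single_term [OF a [unfolded fl_inner_def], of r])
      (auto simp: axis_def fl_exact zero_in_F power2_eq_square)
  then have "t = fl (sqrt (fl (\<bar>c\<bar>\<^sup>2)))"
    by (simp add: t axis_def power2_eq_square)
  then show ?thesis
    using assms fl_sqrt_fl_square [of "\<bar>c\<bar>"] by simp
qed

end

definition tridiagonal_entry :: "(nat \<Rightarrow> real) \<Rightarrow> (nat \<Rightarrow> real) \<Rightarrow> nat \<Rightarrow> nat \<Rightarrow> real" where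
  "tridiagonal_entry \<alpha> \<beta> i j =
     (if i = j then \<alpha> i else if j = i + 1 then \<beta> j else if i = j + 1 then \<beta> i else 0)"

text \<open>
  A matrix that is tridiagonal in an orthonormal basis of signed unit vectors: the j-th of them
  has the entry s j in the coordinate \<sigma> j. This is what the factorization of A by a signed
  permutation and a tridiagonal matrix amounts to.
\<close>

locale signed_tridiagonal = nearest_rounding +
  fixes A :: "real ^ 'n ^ 'n" and \<sigma> :: "nat \<Rightarrow> 'n" and s \<alpha>t \<beta>t :: "nat \<Rightarrow> real"
  assumes \<sigma>: "bij_betw \<sigma> {1..CARD('n)} UNIV"
    and s: "s j = 1 \<or> s j = - 1"
    and A_entry: "\<And>i j. i \<in> {1..CARD('n)} \<Longrightarrow> j \<in> {1..CARD('n)} \<Longrightarrow>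
        A $ \<sigma> i $ \<sigma> j = s i * s j * tridiagonal_entry \<alpha>t \<beta>t i j"
    and \<alpha>t_F: "\<And>j. j \<in> {1..CARD('n)} \<Longrightarrow> \<alpha>t j \<in> F"
    and \<beta>t_F: "\<And>j. j \<in> {1..CARD('n)} \<Longrightarrow> \<beta>t j \<in> F"
    and \<beta>t_pos: "\<And>j. j \<in> {1..CARD('n)} \<Longrightarrow> 0 < \<beta>t j"
    and \<beta>t_range: "\<And>j. j \<in> {1..CARD('n)} \<Longrightarrow> in_exponent_range p emax ((\<beta>t j)\<^sup>2)"
begin

text \<open>
  The basis proper has the indices from 1; the value 0 at the index 0 is the vector that the
  Lanczos algorithm uses in place of a predecessor in its first step.
\<close>

definition basis :: "nat \<Rightarrow> real ^ 'n" where
  "basis j = (if j = 0 then 0 else s j *\<^sub>R axis (\<sigma> j) 1)"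

lemma s_mult [simp]: "s j * s j = 1" "s j * (s j * x) = x"
  using s [of j] by auto

lemma s_nonzero [simp]: "s j \<noteq> 0" and s_abs [simp]: "\<bar>s j\<bar> = 1" and s_F: "s j \<in> F"
  using s [of j] one_in_F F_uminus [OF one_in_F] by auto

lemma s_mult_F: "x \<in> F \<Longrightarrow> s j * x \<in> F"
  using s [of j] F_uminus by auto

lemma \<sigma>_eq_iff [simp]:
  assumes "i \<in> {1..CARD('n)}" "j \<in> {1..CARD('n)}"
  shows "\<sigma> i = \<sigma> j \<longleftrightarrow> i = j"
  using bij_betw_imp_inj_on [OF \<sigma>] assms by (rule inj_on_eq_iff)

lemma vec_eqI:
  fixes x y :: "real ^ 'n"
  assumes "\<And>j. j \<in> {1..CARD('n)} \<Longrightarrow> x $ \<sigma> j = y $ \<sigma> j"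
  shows "x = y"
proof -
  have "x $ r = y $ r" for r
    using bij_betw_imp_surj_on [OF \<sigma>] assms by (metis UNIV_I imageE)
  then show ?thesis
    by (simp add: vec_eq_iff)
qed

lemma basis_component:
  assumes "j \<in> {1..CARD('n)}" "i \<le> CARD('n)"
  shows "basis i $ \<sigma> j = (if i = j then s j else 0)"
  using assms by (auto simp: basis_def axis_def)

lemma tridiagonal_entry_F:
  assumes "i \<in> {1..CARD('n)}" "j \<in> {1..CARD('n)}"
  shows "tridiagonal_entry \<alpha>t \<beta>t i j \<in> F"
  using assms \<alpha>t_F \<beta>t_F zero_in_F by (auto simp: tridiagonal_entry_def)

lemma fl_matvec_basis:
  assumes "fl_matvec fl A (basis i) q" and i: "i \<in> {1..CARD('n)}" and j: "j \<in> {1..CARD('n)}"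
  shows "q $ \<sigma> j = s j * tridiagonal_entry \<alpha>t \<beta>t j i"
proof -
  have "fl_inner fl (A $ \<sigma> j) (s i *\<^sub>R axis (\<sigma> i) 1) (q $ \<sigma> j)"
    using assms by (auto simp: fl_matvec_def basis_def)
  moreover have "A $ \<sigma> j $ \<sigma> i \<in> F"
    using s_mult_F [OF s_mult_F [OF tridiagonal_entry_F [OF j i]]] A_entry [OF j i]
    by (simp add: mult.assoc)
  ultimately have "q $ \<sigma> j = s i * A $ \<sigma> j $ \<sigma> i"
    using s by (intro fl_inner_axis)
  then show ?thesis
    using A_entry [OF j i] by (simp add: mult_ac)
qed

text \<open>
  Every difference is between equal numbers or has a zero operand, and every product outside the
  norm has a factor 0, 1 or -1. So a rounding error can arise only in the square inside the norm,
  where the square root undoes it.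
\<close>

lemma fl_lanczos_step:
  assumes i: "i \<in> {1..CARD('n)}"
    and q: "fl_matvec fl A (basis i) q"
    and w: "w = (\<chi> r. fl (q $ r - fl (\<beta>t i * basis (i - 1) $ r)))"
    and a: "fl_inner fl w (basis i) a"
    and z: "z = (\<chi> r. fl (w $ r - fl (a * basis i $ r)))"
  shows "a = \<alpha>t i"
    and "i < CARD('n) \<Longrightarrow> fl_norm fl z \<beta> \<Longrightarrow>
           \<beta> = \<beta>t (i + 1) \<and> (\<chi> r. fl (z $ r / \<beta>)) = basis (i + 1)"
proof -
  let ?t = "tridiagonal_entry \<alpha>t \<beta>t"
  have w_comp: "w $ \<sigma> j = (if j + 1 = i then 0 else s j * ?t j i)" if j: "j \<in> {1..CARD('n)}" for j
  proof -
    have "s j * ?t j i \<in> F" "s j * \<beta>t i \<in> F"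
      using s_mult_F tridiagonal_entry_F [OF j i] \<beta>t_F [OF i] by auto
    moreover have "basis (i - 1) $ \<sigma> j = (if j + 1 = i then s j else 0)"
      using basis_component [OF j, of "i - 1"] i j by auto
    ultimately show ?thesis
      using fl_matvec_basis [OF q i j] fl_exact zero_in_F
      by (auto simp: w fl_exact mult.commute tridiagonal_entry_def)
  qed
  have "w $ \<sigma> i \<in> F"
    using w_comp [OF i] s_mult_F [OF tridiagonal_entry_F [OF i i]] by simp
  then have "a = s i * w $ \<sigma> i"
    using a s i by (intro fl_inner_axis) (auto simp: basis_def)
  then show a_eq: "a = \<alpha>t i"
    using w_comp [OF i] by (simp add: tridiagonal_entry_def)
  have z_comp: "z $ \<sigma> j = (if j = i + 1 then s j * \<beta>t (i + 1) else 0)" if j: "j \<in> {1..CARD('n)}" for j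
  proof -
    have "s j * ?t j i \<in> F" "s j * \<alpha>t i \<in> F"
      using s_mult_F tridiagonal_entry_F [OF j i] \<alpha>t_F [OF i] by auto
    moreover have "basis i $ \<sigma> j = (if j = i then s j else 0)"
      using basis_component [OF j, of i] i by auto
    ultimately show ?thesis
      using w_comp [OF j] fl_exact zero_in_F
      by (auto simp: z a_eq mult.commute tridiagonal_entry_def)
  qed
  assume less: "i < CARD('n)" and norm: "fl_norm fl z \<beta>"
  have i': "i + 1 \<in> {1..CARD('n)}"
    using less by simp
  have z_eq: "z = (s (i + 1) * \<beta>t (i + 1)) *\<^sub>R axis (\<sigma> (i + 1)) 1"
    by (rule vec_eqI) (use i' in \<open>auto simp: z_comp axis_def\<close>)
  have pos: "0 < \<beta>t (i + 1)"
    using \<beta>t_pos [OF i'] .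
  have sq: "(s (i + 1) * \<beta>t (i + 1))\<^sup>2 = (\<beta>t (i + 1))\<^sup>2"
    by (simp add: power2_eq_square mult_ac)
  have \<beta>: "\<beta> = \<beta>t (i + 1)"
    using fl_norm_axis [OF norm [unfolded z_eq]] \<beta>t_F [OF i'] \<beta>t_range [OF i'] pos
    by (simp add: sq [simplified] abs_mult)
  moreover have "(\<chi> r. fl (z $ r / \<beta>)) = basis (i + 1)"
    by (rule vec_eqI)
      (use i' pos s_F in \<open>auto simp: z_comp \<beta> fl_exact zero_in_F basis_component\<close>)
  ultimately show "\<beta> = \<beta>t (i + 1) \<and> (\<chi> r. fl (z $ r / \<beta>)) = basis (i + 1)"
    by simp
qed

lemma fl_lanczos_exact:
  assumes lanczos: "fl_lanczos fl A (\<beta>t 1 *\<^sub>R basis 1) k \<alpha> \<beta> v" and k: "k \<le> CARD('n)"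
    and i: "i \<in> {1..k}"
  shows "v i = basis i" "\<alpha> i = \<alpha>t i" "\<beta> i = \<beta>t i"
proof -
  have one: "1 \<in> {1..CARD('n)}"
    by (simp add: Suc_le_eq)
  have start: "\<beta> 1 = \<beta>t 1" "v 0 = basis 0" "v 1 = basis 1"
  proof -
    have norm: "fl_norm fl ((\<beta>t 1 * s 1) *\<^sub>R axis (\<sigma> 1) 1) (\<beta> 1)"
      using lanczos by (simp add: fl_lanczos_def basis_def)
    have "(\<beta>t 1 * s 1)\<^sup>2 = (\<beta>t 1)\<^sup>2"
      by (simp add: power2_eq_square mult_ac)
    then show 1: "\<beta> 1 = \<beta>t 1"
      using fl_norm_axis [OF norm] \<beta>t_F [OF one] \<beta>t_range [OF one] \<beta>t_pos [OF one]
      by (simp add: abs_mult)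
    show "v 0 = basis 0"
      using lanczos by (simp add: fl_lanczos_def basis_def)
    have "v 1 = (\<chi> r. fl ((\<beta>t 1 *\<^sub>R basis 1) $ r / \<beta> 1))"
      using lanczos by (simp add: fl_lanczos_def)
    also have "\<dots> = basis 1"
      by (rule vec_eqI)
        (use one \<beta>t_pos [OF one] s_F in \<open>auto simp: 1 [simplified] basis_component fl_exact zero_in_F\<close>)
    finally show "v 1 = basis 1" .
  qed
  have lanczos_step: "\<alpha> i = \<alpha>t i \<and> (i < k \<longrightarrow> \<beta> (i + 1) = \<beta>t (i + 1) \<and> v (i + 1) = basis (i + 1))"
    if i: "i \<in> {1..k}" and v: "v i = basis i" "v (i - 1) = basis (i - 1)"
      and \<beta>: "\<And>j. j \<in> {1..i} \<Longrightarrow> \<beta> j = \<beta>t j" for i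
  proof -
    have in_range: "i \<in> {1..CARD('n)}"
      using i k by simp
    have "\<beta> j \<noteq> 0" if "j \<in> {2..i}" for j
      using \<beta> [of j] \<beta>t_pos [of j] that in_range by auto
    then obtain q w z where
      q: "fl_matvec fl A (v i) q" and w: "w = (\<chi> r. fl (q $ r - fl (\<beta> i * v (i - 1) $ r)))"
      and a: "fl_inner fl w (v i) (\<alpha> i)"
      and z: "i < k \<longrightarrow> z = (\<chi> r. fl (w $ r - fl (\<alpha> i * v i $ r))) \<and> fl_norm fl z (\<beta> (i + 1)) \<and>
                (\<beta> (i + 1) \<noteq> 0 \<longrightarrow> v (i + 1) = (\<chi> r. fl (z $ r / \<beta> (i + 1))))"
      using lanczos i unfolding fl_lanczos_def by blast
    have \<beta>i: "\<beta> i = \<beta>t i"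
      using \<beta> [of i] i by simp
    note step = fl_lanczos_step [OF in_range q [unfolded v] w [unfolded v \<beta>i] a [unfolded v] refl]
    have "\<alpha> i = \<alpha>t i"
      by (rule step(1))
    moreover have "\<beta> (i + 1) = \<beta>t (i + 1) \<and> v (i + 1) = basis (i + 1)" if "i < k"
    proof -
      have less: "i < CARD('n)"
        using that k by simp
      have z': "z = (\<chi> r. fl (w $ r - fl (\<alpha> i * basis i $ r)))" and norm: "fl_norm fl z (\<beta> (i + 1))"
        and v': "\<beta> (i + 1) \<noteq> 0 \<longrightarrow> v (i + 1) = (\<chi> r. fl (z $ r / \<beta> (i + 1)))"
        using z that v by auto
      show ?thesis
        using step(2) [OF less norm [unfolded z']] v' \<beta>t_pos [of "i + 1"] less
        unfolding z' by auto
    qed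
    ultimately show ?thesis by blast
  qed
  have inv: "v i = basis i \<and> v (i - 1) = basis (i - 1) \<and> (\<forall>j\<in>{1..i}. \<beta> j = \<beta>t j)"
    if "1 \<le> i" "i \<le> k" for i
    using that
  proof (induction i rule: dec_induct)
    case base
    then show ?case using start by auto
  next
    case (step n)
    then have n: "n \<in> {1..k}" "n < k" and IH: "v n = basis n" "v (n - 1) = basis (n - 1)"
      "\<And>j. j \<in> {1..n} \<Longrightarrow> \<beta> j = \<beta>t j"
      by auto
    have "\<beta> (n + 1) = \<beta>t (n + 1) \<and> v (n + 1) = basis (n + 1)"
      using lanczos_step [OF n(1) IH] n(2) by blast
    then show ?case
      using IH by (auto simp: le_Suc_eq)
  qed
  show "v i = basis i" "\<beta> i = \<beta>t i"
    using inv [of i] i by auto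
  show "\<alpha> i = \<alpha>t i"
    using lanczos_step [OF i] inv [of i] i by auto
qed

end

section \<open>Positive definite matrices and conjugate gradients\<close>

lemma sym_pos_def_commute:
  assumes "sym_pos_def A"
  shows "x \<bullet> (A *v y) = y \<bullet> (A *v x)"
  using assms unfolding sym_pos_def_def
  by (metis dot_lmul_matrix inner_commute vector_transpose_matrix)

lemma sym_pos_def_nonneg:
  assumes "sym_pos_def A"
  shows "0 \<le> x \<bullet> (A *v x)"
  using assms unfolding sym_pos_def_def by (cases "x = 0") (auto simp: less_imp_le)

lemma sym_pos_def_invertible:
  assumes "sym_pos_def A"
  shows "A *v (matrix_inv A *v x) = x"
proof -
  have "invertible A"
    unfolding invertible_left_inverse matrix_left_invertible_ker
    using assms by (metis inner_zero_right less_irrefl sym_pos_def_def)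
  then have "A ** matrix_inv A = mat 1"
    unfolding invertible_def matrix_inv_def by (rule someI2_ex) simp
  then show ?thesis
    by (simp add: matrix_vector_mul_assoc)
qed

lemma sym_pos_def_Cauchy_Schwarz:
  assumes A: "sym_pos_def A"
  shows "(x \<bullet> (A *v y))\<^sup>2 \<le> (x \<bullet> (A *v x)) * (y \<bullet> (A *v y))"
proof (cases "y = 0")
  case False
  then have pos: "0 < y \<bullet> (A *v y)"
    using A by (simp add: sym_pos_def_def)
  define t where "t = (x \<bullet> (A *v y)) / (y \<bullet> (A *v y))"
  have "0 \<le> (x - t *\<^sub>R y) \<bullet> (A *v (x - t *\<^sub>R y))"
    using A by (rule sym_pos_def_nonneg)
  also have "\<dots> = x \<bullet> (A *v x) - 2 * t * (x \<bullet> (A *v y)) + t * t * (y \<bullet> (A *v y))"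
    using sym_pos_def_commute [OF A, of y x]
    by (simp add: matrix_vector_mult_diff_distrib matrix_vector_mult_scaleR inner_diff algebra_simps)
  also have "\<dots> = x \<bullet> (A *v x) - (x \<bullet> (A *v y))\<^sup>2 / (y \<bullet> (A *v y))"
    using pos by (simp add: t_def power2_eq_square)
  finally show ?thesis
    using pos by (simp add: divide_le_eq)
qed simp

text \<open>
  The reciprocal of the norm of the inverse bounds the quadratic form from below: this is the
  Cauchy-Schwarz inequality in the energy inner product, applied to x and the preimage of x.
\<close>

lemma sym_pos_def_lower_bound:
  assumes A: "sym_pos_def A"
  shows "(norm x)\<^sup>2 \<le> onorm ((*v) (matrix_inv A)) * (x \<bullet> (A *v x))"
proof (cases "x = 0")
  case False
  define y where "y = matrix_inv A *v x"
  have Ay: "A *v y = x"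
    unfolding y_def using A by (rule sym_pos_def_invertible)
  have "norm y \<le> onorm ((*v) (matrix_inv A)) * norm x"
    unfolding y_def by (intro onorm matrix_vector_mul_bounded_linear)
  then have "y \<bullet> x \<le> onorm ((*v) (matrix_inv A)) * norm x * norm x"
    by (meson mult_right_mono norm_cauchy_schwarz norm_ge_zero order_trans)
  then have "(x \<bullet> (A *v x)) * (y \<bullet> x) \<le> (x \<bullet> (A *v x)) * (onorm ((*v) (matrix_inv A)) * (norm x)\<^sup>2)"
    using sym_pos_def_nonneg [OF A] by (intro mult_left_mono) (auto simp: power2_eq_square)
  moreover have "((norm x)\<^sup>2)\<^sup>2 \<le> (x \<bullet> (A *v x)) * (y \<bullet> x)"
    using sym_pos_def_Cauchy_Schwarz [OF A, of x y] by (simp add: Ay power2_norm_eq_inner)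
  ultimately have "(norm x)\<^sup>2 * (norm x)\<^sup>2 \<le> onorm ((*v) (matrix_inv A)) * (x \<bullet> (A *v x)) * (norm x)\<^sup>2"
    by (simp add: power2_eq_square mult_ac)
  then show ?thesis
    by (rule mult_right_le_imp_le) (use False in simp)
qed simp

text \<open>
  Minimality of the energy norm of the error makes the residual orthogonal to the search space:
  along a line in direction w the squared energy norm is a quadratic polynomial, stationary at its
  minimum.
\<close>

lemma cg_residual_orthogonal:
  assumes A: "sym_pos_def A" and xk: "cg_approximation A b k xk" and w: "w \<in> krylov_space A b k"
  shows "w \<bullet> (A *v xk) = w \<bullet> b"
proof (cases "w = 0")
  case False
  then have pos: "0 < w \<bullet> (A *v w)"
    using A by (simp add: sym_pos_def_def)
  obtain x where x: "A *v x = b"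
    and min: "is_arg_min (\<lambda>y. energy_norm A (x - y)) (\<lambda>y. y \<in> krylov_space A b k) xk"
    using xk by (auto simp: cg_approximation_def)
  define e where "e = x - xk"
  define t where "t = (w \<bullet> (A *v e)) / (w \<bullet> (A *v w))"
  have "xk + t *\<^sub>R w \<in> krylov_space A b k"
    using min w unfolding is_arg_min_def krylov_space_def
    by (auto intro: span_add span_scale)
  then have "energy_norm A (x - xk) \<le> energy_norm A (x - (xk + t *\<^sub>R w))"
    using min unfolding is_arg_min_def by (meson not_less)
  then have "e \<bullet> (A *v e) \<le> (e - t *\<^sub>R w) \<bullet> (A *v (e - t *\<^sub>R w))"
    by (simp add: energy_norm_def e_def diff_diff_eq)
  also have "\<dots> = e \<bullet> (A *v e) - 2 * t * (w \<bullet> (A *v e)) + t * t * (w \<bullet> (A *v w))"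
    using sym_pos_def_commute [OF A, of e w]
    by (simp add: matrix_vector_mult_diff_distrib matrix_vector_mult_scaleR inner_diff algebra_simps)
  also have "\<dots> = e \<bullet> (A *v e) - (w \<bullet> (A *v e))\<^sup>2 / (w \<bullet> (A *v w))"
    using pos by (simp add: t_def power2_eq_square)
  finally have "(w \<bullet> (A *v e))\<^sup>2 \<le> 0"
    using pos by (simp add: divide_le_0_iff)
  then have "w \<bullet> (A *v e) = 0"
    by simp
  then show ?thesis
    by (simp add: e_def matrix_vector_mult_diff_distrib x inner_diff_right)
qed simp

section \<open>Krylov spaces of tridiagonal matrices\<close>

lemma krylov_space_mono: "m \<le> k \<Longrightarrow> krylov_space A b m \<subseteq> krylov_space A b k"
  unfolding krylov_space_def by (intro span_mono image_mono) auto

lemma krylov_space_mult: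
  assumes "x \<in> krylov_space A b m"
  shows "A *v x \<in> krylov_space A b (m + 1)"
proof -
  let ?g = "\<lambda>i. ((*v) A ^^ i) b"
  have "A *v x \<in> (*v) A ` span (?g ` {..<m})"
    using assms by (simp add: krylov_space_def)
  also have "\<dots> = span ((*v) A ` ?g ` {..<m})"
    by (rule linear_span_image [symmetric]) simp
  also have "(*v) A ` ?g ` {..<m} = ?g ` Suc ` {..<m}"
    by (simp add: image_image)
  also have "span \<dots> \<subseteq> span (?g ` {..<m + 1})"
    by (intro span_mono image_mono) auto
  finally show ?thesis
    by (simp add: krylov_space_def)
qed

context signed_tridiagonal
begin

lemma sum_coordinates: "(\<Sum>r\<in>UNIV. f r) = (\<Sum>j=1..CARD('n). f (\<sigma> j))" for f :: "'n \<Rightarrow> real"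
  by (rule sum.reindex_bij_betw [OF \<sigma>, symmetric])

lemma mult_component:
  assumes "j \<in> {1..CARD('n)}"
  shows "(A *v x) $ \<sigma> j = s j * (\<Sum>i=1..CARD('n). tridiagonal_entry \<alpha>t \<beta>t j i * (s i * x $ \<sigma> i))"
proof -
  have "(A *v x) $ \<sigma> j = (\<Sum>i=1..CARD('n). A $ \<sigma> j $ \<sigma> i * x $ \<sigma> i)"
    by (simp add: matrix_vector_mult_def sum_coordinates)
  also have "\<dots> = (\<Sum>i=1..CARD('n). s j * (tridiagonal_entry \<alpha>t \<beta>t j i * (s i * x $ \<sigma> i)))"
    using assms by (intro sum.cong) (auto simp: A_entry mult_ac)
  finally show ?thesis
    by (simp add: sum_distrib_left)
qed

definition combination :: "nat \<Rightarrow> (nat \<Rightarrow> real) \<Rightarrow> real ^ 'n" where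
  "combination k x = (\<Sum>i=1..k. x i *\<^sub>R basis i)"

lemma combination_component:
  assumes "k \<le> CARD('n)" "j \<in> {1..CARD('n)}"
  shows "combination k x $ \<sigma> j = (if j \<le> k then s j * x j else 0)"
proof -
  have "combination k x $ \<sigma> j = (\<Sum>i=1..k. if i = j then s j * x j else 0)"
    unfolding combination_def sum_component using assms
    by (intro sum.cong) (auto simp: basis_component)
  then show ?thesis
    using assms by auto
qed

lemma norm_combination:
  assumes "k \<le> CARD('n)"
  shows "(norm (combination k x))\<^sup>2 = (\<Sum>i=1..k. (x i)\<^sup>2)"
proof -
  have "(norm (combination k x))\<^sup>2 = (\<Sum>j=1..CARD('n). (combination k x $ \<sigma> j)\<^sup>2)"
    unfolding power2_norm_eq_inner inner_vec_def sum_coordinates by (simp add: power2_eq_square)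
  also have "\<dots> = (\<Sum>j=1..k. (x j)\<^sup>2)"
    using assms
    by (intro sum.mono_neutral_cong_right)
      (auto simp: combination_component power_mult_distrib power2_eq_square [of "s _"])
  finally show ?thesis .
qed

lemma combination_eqI:
  assumes "k \<le> CARD('n)" and "\<And>j. j \<in> {k<..CARD('n)} \<Longrightarrow> x $ \<sigma> j = 0"
  shows "x = combination k (\<lambda>j. s j * x $ \<sigma> j)"
  by (rule vec_eqI) (use assms in \<open>auto simp: combination_component\<close>)

lemma basis_mult_combination:
  assumes k: "k \<le> CARD('n)" and i: "i \<in> {1..k}"
  shows "basis i \<bullet> (A *v combination k x) = tridiagonal_mult \<alpha>t \<beta>t k x i"
proof -
  have i': "i \<in> {1..CARD('n)}"
    using k i by simp
  have "basis i \<bullet> (A *v combination k x) = s i * (A *v combination k x) $ \<sigma> i"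
    using i by (simp add: basis_def inner_axis')
  also have "\<dots> = (\<Sum>j=1..CARD('n). tridiagonal_entry \<alpha>t \<beta>t i j * (s j * combination k x $ \<sigma> j))"
    by (simp add: mult_component [OF i'])
  also have "\<dots> = (\<Sum>j=1..k. tridiagonal_entry \<alpha>t \<beta>t i j * x j)"
    using k by (intro sum.mono_neutral_cong_right) (auto simp: combination_component)
  also have "\<dots> = (\<Sum>j=1..k. (if j = i then \<alpha>t i * x i else 0)
      + (if j = i + 1 then \<beta>t (i + 1) * x (i + 1) else 0)
      + (if j = i - 1 then \<beta>t i * x (i - 1) else 0))"
    using i by (intro sum.cong) (auto simp: tridiagonal_entry_def)
  also have "\<dots> = tridiagonal_mult \<alpha>t \<beta>t k x i"
    using i by (auto simp: sum.distrib tridiagonal_mult_def)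
  finally show ?thesis .
qed

lemma combination_inner:
  "combination k x \<bullet> y = (\<Sum>i=1..k. x i * (basis i \<bullet> y))"
  by (simp add: combination_def inner_sum_left)

lemma tridiagonal_form_combination:
  assumes k: "k \<le> CARD('n)"
  shows "combination k x \<bullet> (A *v combination k x) = tridiagonal_form \<alpha>t \<beta>t k x"
proof -
  have 1: "(\<Sum>i=1..k. if i = 1 then 0 else \<beta>t i * (x (i - 1) * x i)) = (\<Sum>i=1..<k. \<beta>t (i + 1) * (x i * x (i + 1)))"
  proof -
    have "(\<Sum>i=1..k. if i = 1 then 0 else \<beta>t i * (x (i - 1) * x i)) = (\<Sum>i=Suc 1..<Suc k. \<beta>t i * (x (i - 1) * x i))"
      by (intro sum.mono_neutral_cong_right) auto
    also have "\<dots> = (\<Sum>i=1..<k. \<beta>t (i + 1) * (x i * x (i + 1)))"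
      by (subst sum.shift_bounds_Suc_ivl) simp
    finally show ?thesis .
  qed
  have 2: "(\<Sum>i=1..k. if i = k then 0 else \<beta>t (i + 1) * (x i * x (i + 1))) = (\<Sum>i=1..<k. \<beta>t (i + 1) * (x i * x (i + 1)))"
    by (intro sum.mono_neutral_cong_right) auto
  have "combination k x \<bullet> (A *v combination k x) = (\<Sum>i=1..k. x i * tridiagonal_mult \<alpha>t \<beta>t k x i)"
    unfolding combination_inner using basis_mult_combination [OF k] by (intro sum.cong) auto
  also have "\<dots> = (\<Sum>i=1..k. (if i = 1 then 0 else \<beta>t i * (x (i - 1) * x i)) + \<alpha>t i * (x i)\<^sup>2
      + (if i = k then 0 else \<beta>t (i + 1) * (x i * x (i + 1))))"
    by (intro sum.cong) (auto simp: tridiagonal_mult_def power2_eq_square algebra_simps)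
  also have "\<dots> = tridiagonal_form \<alpha>t \<beta>t k x"
    unfolding sum.distrib 1 2 tridiagonal_form_def by simp
  finally show ?thesis .
qed

lemma mult_basis:
  assumes i: "i \<in> {1..CARD('n)}"
  shows "A *v basis i = \<beta>t i *\<^sub>R basis (i - 1) + \<alpha>t i *\<^sub>R basis i
           + (if i = CARD('n) then 0 else \<beta>t (i + 1) *\<^sub>R basis (i + 1))"
proof (rule vec_eqI)
  fix j assume j: "j \<in> {1..CARD('n)}"
  have "(\<Sum>l=1..CARD('n). tridiagonal_entry \<alpha>t \<beta>t j l * (s l * basis i $ \<sigma> l))
      = (\<Sum>l=1..CARD('n). if l = i then tridiagonal_entry \<alpha>t \<beta>t j i else 0)"
    using i by (intro sum.cong) (auto simp: basis_component)
  then have "(A *v basis i) $ \<sigma> j = s j * tridiagonal_entry \<alpha>t \<beta>t j i"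
    using i by (simp add: mult_component [OF j])
  moreover have "basis i $ \<sigma> j = (if j = i then s j else 0)"
    "basis (i - 1) $ \<sigma> j = (if i = j + 1 then s j else 0)"
    using basis_component [OF j] i j by auto
  moreover have "(if i = CARD('n) then 0 else \<beta>t (i + 1) *\<^sub>R basis (i + 1)) $ \<sigma> j
      = (if j = i + 1 then \<beta>t j * s j else 0)"
    using basis_component [OF j, of "i + 1"] i j by (cases "i = CARD('n)") auto
  ultimately show "(A *v basis i) $ \<sigma> j = (\<beta>t i *\<^sub>R basis (i - 1) + \<alpha>t i *\<^sub>R basis i
           + (if i = CARD('n) then 0 else \<beta>t (i + 1) *\<^sub>R basis (i + 1))) $ \<sigma> j"
    by (simp only: vector_add_component vector_scaleR_component) (simp add: tridiagonal_entry_def)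
qed

text \<open>
  The three-term recurrence expresses a basis vector by the preceding ones and the image of its
  predecessor, because the off-diagonal entries do not vanish.
\<close>

lemma basis_in_krylov_space:
  assumes "1 \<le> i" "i \<le> CARD('n)"
  shows "basis i \<in> krylov_space A (\<beta>t 1 *\<^sub>R basis 1) i"
  using assms
proof (induction i rule: less_induct)
  case (less i)
  let ?K = "krylov_space A (\<beta>t 1 *\<^sub>R basis 1)"
  have subspace: "subspace (?K i)" for i
    by (simp add: krylov_space_def)
  show ?case
  proof (cases "i = 1")
    case True
    have "\<beta>t 1 *\<^sub>R basis 1 \<in> ?K 1"
      unfolding krylov_space_def by (rule span_base) (auto intro: image_eqI [of _ _ 0])
    then have "(1 / \<beta>t 1) *\<^sub>R \<beta>t 1 *\<^sub>R basis 1 \<in> ?K 1"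
      by (rule subspace_scale [OF subspace])
    moreover have "(1 / \<beta>t 1) *\<^sub>R \<beta>t 1 *\<^sub>R basis 1 = basis 1"
      using \<beta>t_pos [of 1] less.prems True by simp
    ultimately show ?thesis
      by (simp only: True)
  next
    case False
    define j where "j = i - 1"
    have ij: "i = j + 1" and j: "1 \<le> j" "j < CARD('n)"
      using False less.prems by (auto simp: j_def)
    have IH: "basis j \<in> ?K j"
      using less.IH [of j] j ij by simp
    have prev: "basis (j - 1) \<in> ?K i"
    proof (cases "j = 1")
      case True
      then have "basis (j - 1) = 0"
        by (simp add: basis_def)
      then show ?thesis
        using subspace_0 [OF subspace] by simp
    next
      case False
      then have "basis (j - 1) \<in> ?K (j - 1)"
        using less.IH [of "j - 1"] j ij by simp
      moreover have "j - 1 \<le> i"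
        using ij by simp
      ultimately show ?thesis
        using krylov_space_mono by blast
    qed
    have "basis j \<in> ?K i" "A *v basis j \<in> ?K i"
      using IH krylov_space_mono [of j i] krylov_space_mult [OF IH] ij by auto
    then have "(1 / \<beta>t i) *\<^sub>R (A *v basis j - \<beta>t j *\<^sub>R basis (j - 1) - \<alpha>t j *\<^sub>R basis j) \<in> ?K i"
      using prev by (intro subspace_scale [OF subspace] subspace_diff [OF subspace])
    also have "A *v basis j - \<beta>t j *\<^sub>R basis (j - 1) - \<alpha>t j *\<^sub>R basis j = \<beta>t i *\<^sub>R basis i"
      using mult_basis [of j] j ij by simp
    finally show ?thesis
      using \<beta>t_pos [of i] less.prems by simp
  qed
qed

text \<open>Each multiplication by a tridiagonal matrix reaches only one further basis vector.\<close>

lemma krylov_space_component: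
  assumes x: "x \<in> krylov_space A (\<beta>t 1 *\<^sub>R basis 1) k" and j: "j \<in> {k<..CARD('n)}"
  shows "x $ \<sigma> j = 0"
proof -
  let ?S = "{x. \<forall>j\<in>{k<..CARD('n)}. x $ \<sigma> j = 0}"
  have powers: "(((*v) A ^^ i) (\<beta>t 1 *\<^sub>R basis 1)) $ \<sigma> j = 0" if "j \<in> {i + 1<..CARD('n)}" for i j
    using that
  proof (induction i arbitrary: j)
    case 0
    then show ?case by (simp add: basis_component)
  next
    case (Suc i)
    have "tridiagonal_entry \<alpha>t \<beta>t j l * (s l * (((*v) A ^^ i) (\<beta>t 1 *\<^sub>R basis 1)) $ \<sigma> l) = 0"
      if l: "l \<in> {1..CARD('n)}" for l
    proof (cases "i + 1 < l")
      case True
      then show ?thesis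
        using Suc.IH [of l] l by simp
    next
      case False
      then show ?thesis
        using Suc.prems by (simp add: tridiagonal_entry_def)
    qed
    then have "(\<Sum>l=1..CARD('n). tridiagonal_entry \<alpha>t \<beta>t j l
        * (s l * (((*v) A ^^ i) (\<beta>t 1 *\<^sub>R basis 1)) $ \<sigma> l)) = 0"
      by (intro sum.neutral ballI)
    then show ?case
      using Suc.prems mult_component [of j "((*v) A ^^ i) (\<beta>t 1 *\<^sub>R basis 1)"] by simp
  qed
  have "krylov_space A (\<beta>t 1 *\<^sub>R basis 1) k \<subseteq> ?S"
    unfolding krylov_space_def
  proof (rule span_minimal)
    show "(\<lambda>i. ((*v) A ^^ i) (\<beta>t 1 *\<^sub>R basis 1)) ` {..<k} \<subseteq> ?S"
      using powers by auto
    show "subspace ?S"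
      by (auto simp: subspace_def)
  qed
  then show ?thesis
    using x j by blast
qed

lemma fl_combination_basis:
  assumes x: "fl_combination fl k v y x" and k: "1 \<le> k" "k \<le> CARD('n)"
    and v: "\<And>j. j \<in> {1..k} \<Longrightarrow> v j = basis j" and y: "\<And>j. j \<in> {1..k} \<Longrightarrow> y j \<in> F"
  shows "x = combination k y"
proof (rule vec_eqI)
  fix i assume i: "i \<in> {1..CARD('n)}"
  have entry: "fl (v j $ \<sigma> i * y j) = (if j = i then s i * y i else 0)" if j: "j \<in> {1..k}" for j
    using basis_component [OF i, of j] v [OF j] y [OF j] j k(2) s_mult_F [OF y]
    by (auto simp: fl_exact zero_in_F)
  have sum: "fl_sum fl {# fl (v j $ \<sigma> i * y j). j \<in># mset_set {1..k} #} (x $ \<sigma> i)"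
    using x by (simp add: fl_combination_def)
  show "x $ \<sigma> i = combination k y $ \<sigma> i"
  proof (cases "i \<le> k")
    case True
    then have ik: "i \<in> {1..k}"
      using i by simp
    have "x $ \<sigma> i = fl (v i $ \<sigma> i * y i)"
      by (rule fl_sum_single_term [OF sum, of i])
        (use ik entry s_mult_F [OF y [OF ik]] in auto)
    then show ?thesis
      using True entry [OF ik] by (simp add: combination_component [OF k(2) i])
  next
    case False
    have "x $ \<sigma> i = fl (v 1 $ \<sigma> i * y 1)"
      by (rule fl_sum_single_term [OF sum, of 1])
        (use False k entry zero_in_F in auto)
    then show ?thesis
      using False k entry [of 1] by (simp add: combination_component [OF k(2) i])
  qed
qed

lemma ldlt_solution_in_F:
  assumes solve: "fl_ldlt_solve fl k \<alpha> \<beta> c l d z g y"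
    and safe: "\<And>x. x \<in> ldlt_exact_results fl k \<alpha> \<beta> l d z g y \<Longrightarrow> no_over_underflow p emax x"
    and j: "j \<in> {1..k}"
  shows "y j \<in> F"
proof (cases "j = k")
  case True
  then have "y j = fl (z j / d j)"
    using solve j by (simp add: fl_ldlt_solve_def)
  moreover have "no_over_underflow p emax (z j / d j)"
    by (rule safe, unfold ldlt_exact_results_def, rule UnI2, rule UN_I [OF j]) simp
  ultimately show ?thesis
    by (simp add: fl_result_in_F)
next
  case False
  then have j': "j \<in> {1..<k}"
    using j by simp
  then have "y j = fl (g j - fl (l j * y (j + 1)))"
    using solve by (simp add: fl_ldlt_solve_def)
  moreover have "no_over_underflow p emax (g j - fl (l j * y (j + 1)))"
    by (rule safe, unfold ldlt_exact_results_def, rule UnI1, rule UN_I [OF j']) simp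
  ultimately show ?thesis
    by (simp add: fl_result_in_F)
qed

text \<open>
  The leading blocks inherit the bounds of A, since their quadratic forms are restrictions of the
  form of A to the spans of the first basis vectors.
\<close>

lemma tridiagonal_form_bounds:
  assumes A: "sym_pos_def A" and m: "m \<le> CARD('n)"
  shows "(\<Sum>i=1..m. (x i)\<^sup>2) \<le> onorm ((*v) (matrix_inv A)) * tridiagonal_form \<alpha>t \<beta>t m x"
    and "tridiagonal_form \<alpha>t \<beta>t m x \<le> onorm ((*v) A) * (\<Sum>i=1..m. (x i)\<^sup>2)"
proof -
  let ?c = "combination m x"
  show "(\<Sum>i=1..m. (x i)\<^sup>2) \<le> onorm ((*v) (matrix_inv A)) * tridiagonal_form \<alpha>t \<beta>t m x"
    using sym_pos_def_lower_bound [OF A, of ?c]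
    by (simp add: norm_combination [OF m] tridiagonal_form_combination [OF m])
  have "?c \<bullet> (A *v ?c) \<le> norm ?c * norm (A *v ?c)"
    by (rule norm_cauchy_schwarz)
  also have "\<dots> \<le> norm ?c * (onorm ((*v) A) * norm ?c)"
    by (intro mult_left_mono onorm matrix_vector_mul_bounded_linear norm_ge_zero)
  also have "\<dots> = onorm ((*v) A) * (\<Sum>i=1..m. (x i)\<^sup>2)"
    unfolding norm_combination [OF m, symmetric] by (simp add: power2_eq_square)
  finally show "tridiagonal_form \<alpha>t \<beta>t m x \<le> onorm ((*v) A) * (\<Sum>i=1..m. (x i)\<^sup>2)"
    by (simp add: tridiagonal_form_combination [OF m])
qed

text \<open>
  The assumption bounds the components of the residual of the combination in the Krylov space,
  where the residual of xk vanishes. Pairing them with the coefficients of the error w bounds the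
  energy of w by \<epsilon> times the form of A between the combinations with absolute values;
  passing to absolute values does not change the norms.
\<close>

lemma residual_error_bound:
  assumes A: "sym_pos_def A" and k: "k \<le> CARD('n)"
    and xk: "cg_approximation A (\<beta>t 1 *\<^sub>R basis 1) k xk"
    and residual: "\<And>i. i \<in> {1..k} \<Longrightarrow>
        \<bar>tridiagonal_mult \<alpha>t \<beta>t k y i - (if i = 1 then \<beta>t 1 else 0)\<bar>
          \<le> \<epsilon> * tridiagonal_mult \<alpha>t \<beta>t k (\<lambda>j. \<bar>y j\<bar>) i"
    and \<epsilon>: "0 \<le> \<epsilon>"
  shows "norm (xk - combination k y) \<le> \<epsilon> * cond_number A * norm (combination k y)"
proof -
  let ?b = "\<beta>t 1 *\<^sub>R basis 1"
  let ?L = "onorm ((*v) (matrix_inv A))" and ?M = "onorm ((*v) A)"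
  define w where "w = xk - combination k y"
  define \<omega> where "\<omega> j = s j * w $ \<sigma> j" for j
  have xk_in: "xk \<in> krylov_space A ?b k"
    using xk unfolding cg_approximation_def is_arg_min_def by auto
  have "w $ \<sigma> j = 0" if "j \<in> {k<..CARD('n)}" for j
    using krylov_space_component [OF xk_in that] combination_component [OF k, of j] that
    by (simp add: w_def)
  then have w: "w = combination k \<omega>"
    unfolding \<omega>_def by (rule combination_eqI [OF k])
  let ?W = "combination k (\<lambda>j. \<bar>\<omega> j\<bar>)" and ?Y = "combination k (\<lambda>j. \<bar>y j\<bar>)"
  have norms: "norm ?W = norm w" "norm ?Y = norm (combination k y)"
    by (rule power2_eq_imp_eq; simp add: norm_combination [OF k] w)+
  have row: "\<bar>basis i \<bullet> (A *v w)\<bar> \<le> \<epsilon> * (basis i \<bullet> (A *v ?Y))" if i: "i \<in> {1..k}" for i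
  proof -
    have i': "i \<in> {1..CARD('n)}"
      using i k by simp
    have "basis i \<in> krylov_space A ?b k"
      using basis_in_krylov_space [of i] krylov_space_mono [of i k A ?b] i k by auto
    then have "basis i \<bullet> (A *v xk) = basis i \<bullet> ?b"
      by (rule cg_residual_orthogonal [OF A xk])
    also have "\<dots> = (if i = 1 then \<beta>t 1 else 0)"
    proof -
      have "basis i \<bullet> basis 1 = s i * basis 1 $ \<sigma> i"
        using i by (simp add: basis_def inner_axis')
      then show ?thesis
        using basis_component [OF i', of 1] i k by auto
    qed
    finally have "basis i \<bullet> (A *v w) = (if i = 1 then \<beta>t 1 else 0) - tridiagonal_mult \<alpha>t \<beta>t k y i"
      by (simp add: w_def matrix_vector_mult_diff_distrib inner_diff_right basis_mult_combination [OF k i])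
    then show ?thesis
      using residual [OF i] by (simp add: basis_mult_combination [OF k i] abs_minus_commute)
  qed
  have "w \<bullet> (A *v w) = (\<Sum>i=1..k. \<omega> i * (basis i \<bullet> (A *v w)))"
    using combination_inner [of k \<omega> "A *v w"] by (simp add: w [symmetric])
  also have "\<dots> \<le> (\<Sum>i=1..k. \<bar>\<omega> i\<bar> * (\<epsilon> * (basis i \<bullet> (A *v ?Y))))"
  proof (rule sum_mono)
    fix i assume "i \<in> {1..k}"
    then have "\<bar>\<omega> i\<bar> * \<bar>basis i \<bullet> (A *v w)\<bar> \<le> \<bar>\<omega> i\<bar> * (\<epsilon> * (basis i \<bullet> (A *v ?Y)))"
      by (intro mult_left_mono row) auto
    then have "\<bar>\<omega> i * (basis i \<bullet> (A *v w))\<bar> \<le> \<bar>\<omega> i\<bar> * (\<epsilon> * (basis i \<bullet> (A *v ?Y)))"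
      unfolding abs_mult .
    then show "\<omega> i * (basis i \<bullet> (A *v w)) \<le> \<bar>\<omega> i\<bar> * (\<epsilon> * (basis i \<bullet> (A *v ?Y)))"
      by (rule order_trans [OF abs_ge_self])
  qed
  also have "\<dots> = \<epsilon> * (?W \<bullet> (A *v ?Y))"
    unfolding combination_inner by (simp add: sum_distrib_left mult_ac)
  also have "\<dots> \<le> \<epsilon> * (norm ?W * (?M * norm ?Y))"
  proof (intro mult_left_mono \<epsilon>)
    have "?W \<bullet> (A *v ?Y) \<le> norm ?W * norm (A *v ?Y)"
      by (rule norm_cauchy_schwarz)
    also have "\<dots> \<le> norm ?W * (?M * norm ?Y)"
      by (intro mult_left_mono onorm matrix_vector_mul_bounded_linear norm_ge_zero)
    finally show "?W \<bullet> (A *v ?Y) \<le> norm ?W * (?M * norm ?Y)" .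
  qed
  finally have energy: "w \<bullet> (A *v w) \<le> \<epsilon> * (norm w * (?M * norm (combination k y)))"
    unfolding norms .
  have "(norm w)\<^sup>2 \<le> ?L * (w \<bullet> (A *v w))"
    by (rule sym_pos_def_lower_bound [OF A])
  also have "\<dots> \<le> ?L * (\<epsilon> * (norm w * (?M * norm (combination k y))))"
    by (intro mult_left_mono energy onorm_pos_le matrix_vector_mul_bounded_linear)
  finally have "norm w * norm w \<le> (\<epsilon> * cond_number A * norm (combination k y)) * norm w"
    by (simp add: cond_number_def power2_eq_square mult_ac)
  moreover have "0 \<le> \<epsilon> * cond_number A * norm (combination k y)"
    unfolding cond_number_def
    by (intro mult_nonneg_nonneg \<epsilon> onorm_pos_le matrix_vector_mul_bounded_linear norm_ge_zero)
  ultimately show ?thesis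
    unfolding w_def [symmetric] by (cases "w = 0") (auto intro: mult_right_le_imp_le)
qed

end

section \<open>The error of the computed approximation\<close>

lemma relative_error_from_computed:
  fixes x y :: "'a::real_normed_vector"
  assumes "norm (x - y) \<le> \<delta> * norm y" and "0 \<le> \<delta>" "\<delta> < 1"
  shows "norm (x - y) / norm x \<le> \<delta> / (1 - \<delta>)"
proof (cases "x = 0")
  case False
  have "norm y \<le> norm x + norm (x - y)"
    using norm_triangle_ineq2 [of y x] by (simp add: norm_minus_commute)
  then have "\<delta> * norm y \<le> \<delta> * (norm x + norm (x - y))"
    using assms(2) by (rule mult_left_mono)
  then have "norm (x - y) * (1 - \<delta>) \<le> \<delta> * norm x"
    using assms(1) by (simp add: algebra_simps)
  then show ?thesis
    using False assms(3) by (simp add: divide_simps mult_ac)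
qed (use assms in simp)

lemma signed_permutation_column:
  assumes P: "P = (\<chi> i j. if i = \<pi> j then s j else (0::real))"
  shows "P *v axis j 1 = s j *\<^sub>R axis (\<pi> j) 1"
  unfolding matrix_vector_mult_basis by (simp add: vec_eq_iff column_def P axis_def)

lemma signed_permutation_conjugate:
  fixes T :: "real ^ 'n ^ 'n"
  assumes P: "P = (\<chi> i j. if i = \<pi> j then s j else (0::real))" and \<pi>: "inj \<pi>"
  shows "(P ** T ** transpose P) $ \<pi> i $ \<pi> j = s i * s j * T $ i $ j"
proof -
  have row: "P $ \<pi> i $ l = (if l = i then s i else 0)" for i l
    using inj_eq [OF \<pi>, of i l] by (auto simp: P)
  have "(P ** T) $ \<pi> i $ l = s i * T $ i $ l" for l
    by (simp add: matrix_matrix_mult_def row if_distrib [of "\<lambda>x. x * _"] cong: if_cong)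
  then show ?thesis
    by (simp add: matrix_matrix_mult_def [of "P ** T"] transpose_def row if_distrib [of "\<lambda>x. _ * x"] cong: if_cong)
qed

theorem theorem5p1:
  fixes p :: nat and emax :: int and fl :: "real \<Rightarrow> real"
    and A P T :: "real ^ 'n ^ 'n" and b x\<^sub>k xbar :: "real ^ 'n"
    and ix :: "nat \<Rightarrow> 'n" and \<alpha>t \<beta>t :: "nat \<Rightarrow> real"
    and k :: nat and \<alpha> \<beta> :: "nat \<Rightarrow> real" and v :: "nat \<Rightarrow> real ^ 'n"
    and l d z g ybar :: "nat \<Rightarrow> real"
  assumes format: "ieee_binary_format p emax"
    and rounding: "round_to_nearest p emax fl"
    and spd: "sym_pos_def A"
    and numbering: "bij_betw ix {1..CARD('n)} UNIV"
    and A_eq: "A = P ** T ** transpose P"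
    and b_eq: "b = \<beta>t 1 *\<^sub>R (P *v axis (ix 1) 1)"
    and P: "signed_permutation_matrix P" "fp_matrix p emax P"
    and T: "sym_tridiagonal ix \<alpha>t \<beta>t T" "fp_matrix p emax T"
    and \<beta>t_1: "\<beta>t 1 \<in> fp_numbers p emax"
    and \<beta>t_pos: "\<And>j. j \<in> {1..CARD('n)} \<Longrightarrow> 0 < \<beta>t j"
    and \<beta>t_range: "\<And>j. j \<in> {1..CARD('n)} \<Longrightarrow> in_exponent_range p emax ((\<beta>t j)\<^sup>2)"
    and k: "1 \<le> k" "k \<le> CARD('n)"
    and lanczos: "fl_lanczos fl A b k \<alpha> \<beta> v"
    and solve: "fl_ldlt_solve fl k \<alpha> \<beta> (\<beta> 1) l d z g ybar"
    and no_exceptions: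
      "\<And>r. r \<in> ldlt_exact_results fl k \<alpha> \<beta> l d z g ybar \<Longrightarrow> no_over_underflow p emax r"
    and xbar: "fl_combination fl k v ybar xbar"
    and xk: "cg_approximation A b k x\<^sub>k"
    and cond: "5 * unit_roundoff p * cond_number A < 1"
  shows "norm (x\<^sub>k - xbar) / norm x\<^sub>k
           \<le> 5 * unit_roundoff p * cond_number A / (1 - 5 * unit_roundoff p * cond_number A)"
proof -
  obtain \<pi> s0 where \<pi>: "bij \<pi>" and s0: "\<And>j. s0 j = 1 \<or> s0 j = - 1"
    and P_eq: "P = (\<chi> i j. if i = \<pi> j then s0 j else 0)"
    using P(1) unfolding signed_permutation_matrix_def by blast
  define \<sigma> where "\<sigma> j = \<pi> (ix j)" for j
  define s where "s j = s0 (ix j)" for j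
  have T_entry: "T $ ix i $ ix j = tridiagonal_entry \<alpha>t \<beta>t i j"
    if "i \<in> {1..CARD('n)}" "j \<in> {1..CARD('n)}" for i j
    using T(1) that unfolding sym_tridiagonal_def tridiagonal_entry_def by blast
  have T_F: "T $ i $ j \<in> fp_numbers p emax" for i j
    using T(2) by (simp add: fp_matrix_def)
  interpret signed_tridiagonal p emax fl A \<sigma> s \<alpha>t \<beta>t
  proof
    show "bij_betw \<sigma> {1..CARD('n)} UNIV"
      using bij_betw_trans [OF numbering \<pi>] by (simp add: \<sigma>_def [abs_def] comp_def)
    show "s j = 1 \<or> s j = - 1" for j
      using s0 by (simp add: s_def)
    show "A $ \<sigma> i $ \<sigma> j = s i * s j * tridiagonal_entry \<alpha>t \<beta>t i j"
      if "i \<in> {1..CARD('n)}" "j \<in> {1..CARD('n)}" for i j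
      unfolding A_eq \<sigma>_def s_def signed_permutation_conjugate [OF P_eq bij_is_inj [OF \<pi>]] T_entry [OF that] ..
    show "\<alpha>t j \<in> fp_numbers p emax" if j: "j \<in> {1..CARD('n)}" for j
      using T_F [of "ix j" "ix j"] T_entry [OF j j] by (simp add: tridiagonal_entry_def)
    show "\<beta>t j \<in> fp_numbers p emax" if j: "j \<in> {1..CARD('n)}" for j
    proof (cases "j = 1")
      case False
      then have "j - 1 \<in> {1..CARD('n)}"
        using j by auto
      then show ?thesis
        using T_F [of "ix (j - 1)" "ix j"] T_entry [of "j - 1" j] j False
        by (simp add: tridiagonal_entry_def split: if_splits)
    qed (use \<beta>t_1 in simp)
  qed (use format rounding \<beta>t_pos \<beta>t_range in auto)
  have b: "b = \<beta>t 1 *\<^sub>R basis 1"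
    by (simp add: b_eq signed_permutation_column [OF P_eq] basis_def \<sigma>_def s_def)
  have exact: "v i = basis i" "\<alpha> i = \<alpha>t i" "\<beta> i = \<beta>t i" if "i \<in> {1..k}" for i
    using fl_lanczos_exact [OF lanczos [unfolded b] k(2) that] .
  have xbar_eq: "xbar = combination k ybar"
    using exact(1) ldlt_solution_in_F [OF solve no_exceptions]
    by (rule fl_combination_basis [OF xbar k])
  let ?L = "onorm ((*v) (matrix_inv A))" and ?M = "onorm ((*v) A)"
  \<comment> \<open>The form at the first basis vector shows that both norms are positive.\<close>
  have unit: "1 \<le> ?L * tridiagonal_form \<alpha>t \<beta>t 1 (\<lambda>_. 1)" "tridiagonal_form \<alpha>t \<beta>t 1 (\<lambda>_. 1) \<le> ?M"
    using tridiagonal_form_bounds [OF spd, of 1 "\<lambda>_. 1"] k by auto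
  have L: "0 < ?L"
    using unit(1) onorm_pos_le [of "(*v) (matrix_inv A)"] by (cases "?L = 0") auto
  have "0 < ?L * tridiagonal_form \<alpha>t \<beta>t 1 (\<lambda>_. 1)"
    using unit(1) by linarith
  then have M: "0 < ?M"
    using L unit(2) by (simp add: zero_less_mult_iff)
  have form: "tridiagonal_form \<alpha> \<beta> m x = tridiagonal_form \<alpha>t \<beta>t m x" if "m \<in> {1..k}" for m x
    unfolding tridiagonal_form_def using exact that
    by (intro arg_cong2 [of _ _ _ _ "(+)"] arg_cong2 [of _ _ _ _ "(*)"] refl sum.cong) auto
  have mult: "tridiagonal_mult \<alpha> \<beta> k x i = tridiagonal_mult \<alpha>t \<beta>t k x i" if "i \<in> {1..k}" for x i
    using exact that by (simp add: tridiagonal_mult_def)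
  have "\<bar>tridiagonal_mult \<alpha>t \<beta>t k ybar i - (if i = 1 then \<beta>t 1 else 0)\<bar>
      \<le> 5 * u * tridiagonal_mult \<alpha>t \<beta>t k (\<lambda>j. \<bar>ybar j\<bar>) i" if i: "i \<in> {1..k}" for i
  proof -
    have "\<bar>tridiagonal_mult \<alpha> \<beta> k ybar i - (if i = 1 then \<beta> 1 else 0)\<bar>
        \<le> 5 * u * tridiagonal_mult \<alpha> \<beta> k (\<lambda>j. \<bar>ybar j\<bar>) i"
    proof (rule ldlt_residual [OF k(1) solve no_exceptions _ _ _ M _ i])
      show "0 < \<beta> (i + 1)" if "i \<in> {1..<k}" for i
        using that exact(3) [of "i + 1"] \<beta>t_pos [of "i + 1"] k by simp
      show "1 / ?L * (\<Sum>i=1..m. (x i)\<^sup>2) \<le> tridiagonal_form \<alpha> \<beta> m x" if "m \<in> {1..k}" for m x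
        using tridiagonal_form_bounds(1) [OF spd, of m x] that k L form [OF that]
        by (simp add: divide_le_eq mult.commute)
      show "tridiagonal_form \<alpha> \<beta> m x \<le> ?M * (\<Sum>i=1..m. (x i)\<^sup>2)" if "m \<in> {1..k}" for m x
        using tridiagonal_form_bounds(2) [OF spd, of m x] that k form [OF that] by simp
      show "5 * u * ?M \<le> 1 / ?L"
        using cond L by (simp add: cond_number_def le_divide_eq mult_ac)
    qed
    then show ?thesis
      using exact(3) [of 1] k by (simp only: mult [OF i]) auto
  qed
  then have "norm (x\<^sub>k - xbar) \<le> 5 * u * cond_number A * norm xbar"
    unfolding xbar_eq using u_pos by (intro residual_error_bound spd k xk [unfolded b]) auto
  then show ?thesis
  proof (rule relative_error_from_computed)
    show "0 \<le> 5 * u * cond_number A"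
      unfolding cond_number_def using u_pos L M by simp
  qed (rule cond)
qed

end
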